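(* Let $d$ be fixed and $0<c<1$. With probability tending to $1$ as $n\to\infty$, a uniformly random element of $\mathcal{G}_{d,c}(n)$ has fewer than $\frac{\log\log n}{\log n}\, n$ bad nodes. Consequently, the number of triangles of such a graph that are not part of a $(d+1)$-clique is $o(n)$.
   Context: $T_{\max}=\binom{d}{2}\frac{n}{3}$. $\mathcal{G}_{d,c}(n)$ is the set of $d$-regular graphs on $n$ labeled nodes containing at least $c\cdot T_{\max}$ triangles. A node of a graph is called bad if it is incident to at least one triangle but is not contained in any clique on $d+1$ nodes. *)

theory Defs
  imports Complex_Main
begin

definition simple_graph :: "nat \<Rightarrow> nat set set \<Rightarrow> bool" where
  "simple_graph n E \<longleftrightarrow> (\<forall>e\<in>E. e \<subseteq> {..<n} \<and> card e = 2)"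

definition degree :: "nat set set \<Rightarrow> nat \<Rightarrow> nat" where
  "degree E v = card {u. {u, v} \<in> E}"

definition regular :: "nat \<Rightarrow> nat \<Rightarrow> nat set set \<Rightarrow> bool" where
  "regular d n E \<longleftrightarrow> (\<forall>v<n. degree E v = d)"

definition is_clique :: "nat \<Rightarrow> nat set set \<Rightarrow> nat set \<Rightarrow> bool" where
  "is_clique n E K \<longleftrightarrow> K \<subseteq> {..<n} \<and> (\<forall>u\<in>K. \<forall>v\<in>K. u \<noteq> v \<longrightarrow> {u, v} \<in> E)"

definition triangles :: "nat \<Rightarrow> nat set set \<Rightarrow> nat set set" where
  "triangles n E = {T. is_clique n E T \<and> card T = 3}"

definition T_max :: "nat \<Rightarrow> nat \<Rightarrow> real" where
  "T_max d n = real (d choose 2) * real n / 3"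

definition G_dc :: "nat \<Rightarrow> real \<Rightarrow> nat \<Rightarrow> nat set set set" where
  "G_dc d c n = {E. simple_graph n E \<and> regular d n E \<and>
                    real (card (triangles n E)) \<ge> c * T_max d n}"

definition bad_nodes :: "nat \<Rightarrow> nat \<Rightarrow> nat set set \<Rightarrow> nat set" where
  "bad_nodes d n E = {v. v < n \<and> (\<exists>T\<in>triangles n E. v \<in> T) \<and>
        \<not> (\<exists>K. is_clique n E K \<and> card K = d + 1 \<and> v \<in> K)}"

definition nonclique_triangles :: "nat \<Rightarrow> nat \<Rightarrow> nat set set \<Rightarrow> nat set set" where
  "nonclique_triangles d n E = {T\<in>triangles n E.
        \<not> (\<exists>K. is_clique n E K \<and> card K = d + 1 \<and> T \<subseteq> K)}"

definition prob_G :: "nat \<Rightarrow> real \<Rightarrow> nat \<Rightarrow> (nat set set \<Rightarrow> bool) \<Rightarrow> real" where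
  "prob_G d c n P = real (card {E\<in>G_dc d c n. P E}) / real (card (G_dc d c n))"

end

theory Submission
  imports Defs "HOL-Combinatorics.Permutations" "HOL-Library.FuncSet" "HOL-Number_Theory.Cong"
    "HOL-Real_Asymp.Real_Asymp"
begin

text \<open>
  Reveal a \<open>d\<close>-regular graph node by node in a random order. An edge with \<open>k\<close> common neighbours
  costs a factor \<open>n\<close> unless one of these neighbours precedes both of its ends, in which case it
  costs only \<open>O(1)\<close>; the latter has probability \<open>k / (k + 2) \<ge> k / (d + 1)\<close>, with equality only
  for \<open>k = 0\<close> and \<open>k = d - 1\<close>. Summing over the edges, a graph with \<open>t\<close> triangles costs at most
  \<open>d n / 2 - 3 t / (d + 1)\<close> factors \<open>n\<close>, and since every bad node lies on an edge with
  \<open>0 < k < d - 1\<close>, having \<open>b\<close> bad nodes saves a further number of factors proportional to \<open>b\<close>.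
  On the other hand, disjoint cliques together with an arbitrary lift of the complete graph on
  \<open>d + 1\<close> nodes show that, up to exponential factors, the first bound is attained.
  With \<open>b = n ln (ln n) / ln n\<close> the saving \<open>n powr (\<epsilon> b) = (ln n) powr (\<epsilon> n)\<close> beats
  every exponential factor.
\<close>

section \<open>Codegrees, triangles and bad nodes\<close>

definition nbs :: "nat set set \<Rightarrow> nat \<Rightarrow> nat set" where
  "nbs E v = {u. {u, v} \<in> E}"

text \<open>Taking a set instead of two nodes makes this a function of an unordered edge; its
  cardinality is the codegree of the edge.\<close>

definition common_nbs :: "nat set set \<Rightarrow> nat set \<Rightarrow> nat set" where
  "common_nbs E e = {u. \<forall>v\<in>e. {u, v} \<in> E}"

lemma in_nbs_iff: "u \<in> nbs E v \<longleftrightarrow> {u, v} \<in> E"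
  by (simp add: nbs_def)

lemma nbs_sym: "u \<in> nbs E v \<longleftrightarrow> v \<in> nbs E u"
  by (simp add: nbs_def insert_commute)

lemma degree_eq_card_nbs: "degree E v = card (nbs E v)"
  by (simp add: degree_def nbs_def)

lemma common_nbs_pair: "common_nbs E {v, w} = nbs E v \<inter> nbs E w"
  by (auto simp: common_nbs_def nbs_def)

lemma simple_graph_subset_Pow: "simple_graph n E \<Longrightarrow> E \<subseteq> Pow {..<n}"
  by (auto simp: simple_graph_def)

lemma finite_simple_graphs: "finite {E. simple_graph n E}"
  by (rule finite_subset[of _ "Pow (Pow {..<n})"]) (auto dest: simple_graph_subset_Pow)

lemma simple_graph_finite: "simple_graph n E \<Longrightarrow> finite E"
  by (meson finite_Pow_iff finite_lessThan finite_subset simple_graph_subset_Pow)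

lemma simple_graph_edge:
  assumes "simple_graph n E" "{u, v} \<in> E"
  shows "u < n" "v < n" "u \<noteq> v"
  using assms by (auto simp: simple_graph_def dest!: bspec)

lemma simple_graph_edgeE:
  assumes "simple_graph n E" "e \<in> E"
  obtains u v where "e = {u, v}" "u \<noteq> v" "u < n" "v < n"
  using assms by (fastforce simp: simple_graph_def card_2_iff)

lemma nbs_subset: "simple_graph n E \<Longrightarrow> nbs E v \<subseteq> {..<n}"
  unfolding nbs_def using simple_graph_edge(1) by blast

lemma finite_nbs: "simple_graph n E \<Longrightarrow> finite (nbs E v)"
  by (rule finite_subset[OF nbs_subset]) auto

lemma notin_nbs_self: "simple_graph n E \<Longrightarrow> v \<notin> nbs E v"
  unfolding nbs_def using simple_graph_edge(3) by blast

lemma simple_graph_eqI: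
  assumes "simple_graph n E" "simple_graph n E'" "\<And>v. v < n \<Longrightarrow> nbs E v = nbs E' v"
  shows "E = E'"
proof -
  have "\<And>e. e \<in> E \<longleftrightarrow> e \<in> E'"
    using assms by (metis in_nbs_iff simple_graph_edgeE)
  then show ?thesis by blast
qed

section \<open>Double counting of edges and triangles\<close>

lemma edges_at_eq_image:
  assumes "simple_graph n E"
  shows "{e \<in> E. v \<in> e} = (\<lambda>u. {u, v}) ` nbs E v"
proof -
  have "e \<in> (\<lambda>u. {u, v}) ` nbs E v" if "e \<in> E" "v \<in> e" for e
    using that assms by (elim simple_graph_edgeE[of n E e]) (auto simp: nbs_def insert_commute)
  then show ?thesis by (auto simp: nbs_def)
qed

lemma card_edges_at:
  assumes "simple_graph n E"
  shows "card {e \<in> E. v \<in> e} = degree E v"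
  unfolding edges_at_eq_image[OF assms] degree_eq_card_nbs
  by (rule card_image) (auto simp: inj_on_def doubleton_eq_iff)

lemma handshake:
  assumes "simple_graph n E"
  shows "(\<Sum>v<n. degree E v) = 2 * card E"
proof -
  have "{v \<in> {..<n}. v \<in> e} = e" if "e \<in> E" for e
    using that assms by (auto simp: simple_graph_def)
  then have "(\<Sum>v<n. card {e \<in> E. v \<in> e}) = (\<Sum>e\<in>E. 2)"
    using assms simple_graph_finite[OF assms] by (intro sum_multicount_gen) (auto simp: simple_graph_def)
  then show ?thesis using card_edges_at[OF assms] by simp
qed

lemma finite_triangles: "finite (triangles n E)"
  by (rule finite_subset[of _ "Pow {..<n}"]) (auto simp: triangles_def is_clique_def)

lemma common_nbs_finite:
  assumes "simple_graph n E" "e \<in> E"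
  shows "finite (common_nbs E e)"
proof -
  obtain u v where "e = {u, v}" using simple_graph_edgeE[OF assms] by metis
  then show ?thesis using finite_nbs[OF assms(1)] by (simp add: common_nbs_pair)
qed

text \<open>A triangle on \<open>e\<close> is determined by its third node, a common neighbour of
  the ends.\<close>

lemma card_triangles_containing_edge:
  assumes E: "simple_graph n E" and e: "e \<in> E"
  shows "card {T \<in> triangles n E. e \<subseteq> T} = card (common_nbs E e)"
proof -
  obtain v w where vw: "e = {v, w}" "v \<noteq> w" "v < n" "w < n"
    using simple_graph_edgeE[OF E e] by blast
  have "{T \<in> triangles n E. e \<subseteq> T} = (\<lambda>u. insert u e) ` common_nbs E e"
  proof (intro equalityI subsetI)
    fix T assume T: "T \<in> {T \<in> triangles n E. e \<subseteq> T}"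
    then have "card (T - e) = 1"
      using vw by (subst card_Diff_subset) (auto simp: triangles_def)
    then obtain u where u: "T - e = {u}" by (auto simp: card_1_singleton_iff)
    then have "T = insert u e" "u \<notin> e" using T by auto
    moreover have "u \<in> common_nbs E e"
    proof -
      have "{u, v} \<in> E" if "v \<in> e" for v
      proof -
        have "u \<in> T" "v \<in> T" "u \<noteq> v" using T u that by auto
        then show ?thesis using T by (simp add: triangles_def is_clique_def)
      qed
      then show ?thesis by (simp add: common_nbs_def)
    qed
    ultimately show "T \<in> (\<lambda>u. insert u e) ` common_nbs E e" by blast
  next
    fix T assume "T \<in> (\<lambda>u. insert u e) ` common_nbs E e"
    then obtain u where u: "T = {u, v, w}" "{u, v} \<in> E" "{u, w} \<in> E"
      by (auto simp: common_nbs_def vw)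
    then have "u \<noteq> v" "u \<noteq> w" "u < n" using simple_graph_edge[OF E] by blast+
    then show "T \<in> {T \<in> triangles n E. e \<subseteq> T}"
      using u e vw by (auto simp: triangles_def is_clique_def insert_commute)
  qed
  moreover have "inj_on (\<lambda>u. insert u e) (common_nbs E e)"
  proof (rule inj_onI)
    fix x y assume xy: "x \<in> common_nbs E e" "y \<in> common_nbs E e" "insert x e = insert y e"
    have "z \<notin> e" if "z \<in> common_nbs E e" for z
      using that simple_graph_edge(3)[OF E, of z z] by (auto simp: common_nbs_def)
    then have "x \<notin> e" "y \<notin> e" using xy by blast+
    then show "x = y" using xy(3) by blast
  qed
  ultimately show ?thesis by (simp add: card_image)
qed

text \<open>Count the pairs of a triangle and one of its edges: every triangle has three
  edges.\<close>

lemma sum_common_nbs: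
  assumes "simple_graph n E"
  shows "(\<Sum>e\<in>E. card (common_nbs E e)) = 3 * card (triangles n E)"
proof -
  have "card {e \<in> E. e \<subseteq> T} = 3" if "T \<in> triangles n E" for T
  proof -
    have T: "T \<subseteq> {..<n}" "card T = 3" "\<And>u v. u \<in> T \<Longrightarrow> v \<in> T \<Longrightarrow> u \<noteq> v \<Longrightarrow> {u, v} \<in> E"
      using that by (auto simp: triangles_def is_clique_def)
    have "{e \<in> E. e \<subseteq> T} = {e. e \<subseteq> T \<and> card e = 2}"
      using T assms by (auto simp: simple_graph_def card_2_iff)
    moreover have "finite T" using T finite_subset by blast
    ultimately show ?thesis using T by (simp add: n_subsets numeral_eq_Suc)
  qed
  then have "(\<Sum>e\<in>E. card {T \<in> triangles n E. e \<subseteq> T}) = (\<Sum>T\<in>triangles n E. 3)"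
    using simple_graph_finite[OF assms] by (intro sum_multicount_gen) (auto simp: finite_triangles)
  then show ?thesis using card_triangles_containing_edge[OF assms] by simp
qed

lemma card_common_nbs_less:
  assumes E: "simple_graph n E" "regular d n E" and e: "e \<in> E"
  shows "card (common_nbs E e) + 1 \<le> d"
proof -
  obtain v w where vw: "e = {v, w}" "v \<noteq> w" "v < n" "w < n"
    using simple_graph_edgeE[OF E(1) e] by blast
  have "common_nbs E e \<subseteq> nbs E v - {w}"
    using notin_nbs_self[OF E(1)] by (auto simp: vw common_nbs_pair)
  then have "card (common_nbs E e) \<le> card (nbs E v - {w})"
    using finite_nbs[OF E(1)] by (intro card_mono) auto
  moreover have wv: "w \<in> nbs E v" using e vw by (simp add: nbs_def insert_commute)
  moreover have "card (nbs E v) = d" using E(2) vw by (simp add: regular_def degree_eq_card_nbs)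
  moreover have "card (nbs E v) > 0" using wv finite_nbs[OF E(1)] card_gt_0_iff by blast
  ultimately show ?thesis by simp
qed

text \<open>The edges at which the inequality \<open>k / (k + 2) \<ge> k / (d + 1)\<close> for the codegree \<open>k\<close>
  is strict.\<close>

definition partial_edges :: "nat \<Rightarrow> nat set set \<Rightarrow> nat set set" where
  "partial_edges d E = {e \<in> E. 0 < card (common_nbs E e) \<and> card (common_nbs E e) + 1 < d}"

text \<open>Otherwise every edge at \<open>v\<close> has codegree \<open>0\<close> or
  \<open>d - 1\<close>. Some neighbour \<open>a\<close> lies with \<open>v\<close> in a triangle, so
  \<open>a\<close> is joined to all other neighbours of \<open>v\<close>; this spreads to every
  neighbour, and \<open>v\<close> would lie in a clique on \<open>d + 1\<close> nodes.\<close>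

lemma bad_node_partial_edge:
  assumes E: "simple_graph n E" "regular d n E" and v: "v \<in> bad_nodes d n E"
  shows "\<exists>e\<in>partial_edges d E. v \<in> e"
proof (rule ccontr)
  assume "\<not> (\<exists>e\<in>partial_edges d E. v \<in> e)"
  then have dich: "card (common_nbs E {v, w}) = 0 \<or> card (common_nbs E {v, w}) + 1 = d"
    if "w \<in> nbs E v" for w
    using that card_common_nbs_less[OF E, of "{v, w}"]
    by (force simp: partial_edges_def nbs_def insert_commute)
  have vn: "v < n" and nocl: "\<not> (\<exists>K. is_clique n E K \<and> card K = d + 1 \<and> v \<in> K)"
    using v by (auto simp: bad_nodes_def)
  have deg: "card (nbs E v) = d" using E(2) vn by (simp add: regular_def degree_eq_card_nbs)
  note fin = finite_nbs[OF E(1)]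
  have full: "common_nbs E {v, w} = nbs E v - {w}"
    if w: "w \<in> nbs E v" and "common_nbs E {v, w} \<noteq> {}" for w
  proof (rule card_subset_eq)
    show "finite (nbs E v - {w})" using fin by blast
    show "common_nbs E {v, w} \<subseteq> nbs E v - {w}"
      using notin_nbs_self[OF E(1)] by (auto simp: common_nbs_pair)
    have "card (common_nbs E {v, w}) \<noteq> 0" using that fin by (auto simp: common_nbs_pair)
    then show "card (common_nbs E {v, w}) = card (nbs E v - {w})"
      using dich[OF w] w deg fin by (simp add: card_Diff_singleton)
  qed
  obtain T where T: "is_clique n E T" "card T = 3" "v \<in> T"
    using v by (auto simp: bad_nodes_def triangles_def)
  have "card (T - {v}) = 2" using T by (simp add: card_Diff_singleton)
  then obtain a b where ab: "T - {v} = {a, b}" "a \<noteq> b" by (auto simp: card_2_iff)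
  then have "a \<in> T" "b \<in> T" "a \<noteq> v" "b \<noteq> v" by blast+
  moreover have "\<And>x y. x \<in> T \<Longrightarrow> y \<in> T \<Longrightarrow> x \<noteq> y \<Longrightarrow> x \<in> nbs E y"
    using T(1) by (simp add: nbs_def is_clique_def)
  ultimately have a: "a \<in> nbs E v" "b \<in> nbs E v \<inter> nbs E a"
    using T(3) ab(2) by auto
  then have fa: "nbs E v \<inter> nbs E a = nbs E v - {a}" using full[of a] by (auto simp: common_nbs_pair)
  \<comment> \<open>Saturation spreads from \<open>a\<close>: any other \<open>w\<close> shares the
    neighbour \<open>a\<close> with \<open>v\<close>, so its codegree with \<open>v\<close> is
    positive and hence maximal.\<close>
  have "nbs E v \<inter> nbs E w = nbs E v - {w}" if w: "w \<in> nbs E v" for w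
  proof (cases "w = a")
    case False
    then have "w \<in> nbs E a" using fa w by blast
    then have "a \<in> common_nbs E {v, w}" using a nbs_sym by (auto simp: common_nbs_pair)
    then show ?thesis using full[OF w] by (auto simp: common_nbs_pair)
  qed (use fa in simp)
  then have "{u, w} \<in> E" if "u \<in> nbs E v" "w \<in> nbs E v" "u \<noteq> w" for u w
    using that by (auto simp: nbs_def)
  then have "is_clique n E (insert v (nbs E v))"
    using vn nbs_subset[OF E(1), of v] by (auto simp: is_clique_def nbs_def insert_commute)
  moreover have "card (insert v (nbs E v)) = d + 1"
    using fin notin_nbs_self[OF E(1)] deg by simp
  ultimately show False using nocl by blast
qed

text \<open>The partial edges cover the bad nodes, and each covers two nodes.\<close>

lemma card_bad_nodes_le:
  assumes E: "simple_graph n E" "regular d n E"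
  shows "card (bad_nodes d n E) \<le> 2 * card (partial_edges d E)"
proof -
  have fin: "finite (partial_edges d E)"
    using simple_graph_finite[OF E(1)] by (simp add: partial_edges_def)
  have fe: "finite e \<and> card e = 2" if "e \<in> partial_edges d E" for e
    using that E(1) by (auto simp: partial_edges_def simple_graph_def intro: finite_subset)
  have "bad_nodes d n E \<subseteq> \<Union> (partial_edges d E)"
    using bad_node_partial_edge[OF E] by blast
  then have "card (bad_nodes d n E) \<le> card (\<Union> (partial_edges d E))"
    using fin fe by (intro card_mono) auto
  also have "\<dots> \<le> (\<Sum>e\<in>partial_edges d E. card e)"
    using card_UN_le[OF fin, of "\<lambda>e. e"] by simp
  also have "\<dots> = 2 * card (partial_edges d E)" using fe by simp
  finally show ?thesis .
qed

text \<open>The left side will be the mean number of paid edges under a random order. Sum a linear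
  bound in the codegree over the \<open>d n / 2\<close> edges: the codegrees add up to three times
  the triangles, and every partial edge saves an extra \<open>1 / (d + 1)\<^sup>2\<close>, for at
  least half as many edges as there are bad nodes.\<close>

lemma sum_two_over_le:
  assumes E: "simple_graph n E" "regular d n E"
  shows "(\<Sum>e\<in>E. 2 / (real (card (common_nbs E e)) + 2))
    \<le> real d * real n / 2 - 3 * real (card (triangles n E)) / (real d + 1)
        - real (card (bad_nodes d n E)) / (2 * (real d + 1)\<^sup>2)"
proof -
  have fin: "finite E" using simple_graph_finite[OF E(1)] .
  \<comment> \<open>The gap is \<open>k (d - 1 - k) / ((k + 2) (d + 1))\<close>. It vanishes at
    \<open>k = 0\<close> and \<open>k = d - 1\<close>; in between the numerator is at least
    \<open>1\<close> and \<open>k + 2 \<le> d\<close>.\<close>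
  have key: "2 / (real k + 2) \<le> 1 - real k / (real d + 1) - (if 0 < k \<and> k + 1 < d then 1 else 0) / (real d + 1)\<^sup>2"
    if k: "k + 1 \<le> d" for k
  proof (cases "0 < k \<and> k + 1 < d")
    case True
    then obtain k' where k': "k = Suc k'" by (cases k) auto
    obtain j where j: "d = k + 2 + j"
    proof -
      have "\<exists>j. d = k + 2 + j" using True by presburger
      then show ?thesis using that by blast
    qed
    have "1 / (real d + 1)\<^sup>2 \<le> real k * (1 + real j) / ((real k + 2) * (real d + 1))"
    proof (rule frac_le)
      show "1 \<le> real k * (1 + real j)" "0 \<le> real k * (1 + real j)" by (simp_all add: k' algebra_simps)
      show "0 < (real k + 2) * (real d + 1)" by (intro mult_pos_pos) auto
      show "(real k + 2) * (real d + 1) \<le> (real d + 1)\<^sup>2"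
        unfolding power2_eq_square by (intro mult_right_mono) (auto simp: j)
    qed
    also have "real k * (1 + real j) = (real k + 2) * (real d + 1) - real k * (real k + 2) - 2 * (real d + 1)"
      by (simp add: j algebra_simps)
    also have "\<dots> / ((real k + 2) * (real d + 1)) = 1 - real k / (real d + 1) - 2 / (real k + 2)"
    proof -
      have "real k + 2 \<noteq> 0" "real d + 1 \<noteq> 0" by linarith+
      then show ?thesis by (simp add: field_simps)
    qed
    finally show ?thesis using True by simp
  next
    case False
    have "k = 0 \<or> d = k + 1" using False k by auto
    then show ?thesis by (auto simp: divide_simps)
  qed
  have "(\<Sum>e\<in>E. 2 / (real (card (common_nbs E e)) + 2))
     \<le> (\<Sum>e\<in>E. 1 - real (card (common_nbs E e)) / (real d + 1)
           - (if 0 < card (common_nbs E e) \<and> card (common_nbs E e) + 1 < d then 1 else 0) / (real d + 1)\<^sup>2)"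
    using key card_common_nbs_less[OF E] by (intro sum_mono) blast
  also have "\<dots> = real (card E) - real (\<Sum>e\<in>E. card (common_nbs E e)) / (real d + 1)
       - real (card (partial_edges d E)) / (real d + 1)\<^sup>2"
    using fin by (simp add: sum_subtractf sum_divide_distrib[symmetric] partial_edges_def
        sum.If_cases Int_def of_nat_sum)
  also have "real (card E) = real d * real n / 2"
  proof -
    have "n * d = 2 * card E" using handshake[OF E(1)] E(2) by (simp add: regular_def)
    then have "real n * real d = 2 * real (card E)" by (metis of_nat_mult of_nat_numeral)
    then show ?thesis by (simp add: mult.commute)
  qed
  also have "real (\<Sum>e\<in>E. card (common_nbs E e)) = 3 * real (card (triangles n E))"
    using sum_common_nbs[OF E(1)] by simp
  finally have "(\<Sum>e\<in>E. 2 / (real (card (common_nbs E e)) + 2))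
      \<le> real d * real n / 2 - 3 * real (card (triangles n E)) / (real d + 1)
        - real (card (partial_edges d E)) / (real d + 1)\<^sup>2" .
  moreover have "real (card (bad_nodes d n E)) / (2 * (real d + 1)\<^sup>2) \<le> real (card (partial_edges d E)) / (real d + 1)\<^sup>2"
  proof -
    have "real (card (bad_nodes d n E)) \<le> 2 * real (card (partial_edges d E))"
      using card_bad_nodes_le[OF E] by linarith
    then show ?thesis by (simp add: divide_simps)
  qed
  ultimately show ?thesis by simp
qed

section \<open>Encoding a graph along an ordering of its nodes\<close>

text \<open>Reveal the nodes in the order given by \<open>\<sigma>\<close>. An edge that is not \<open>paid\<close> joins two
  neighbours of an earlier node, so its later end is among at most \<open>d * d\<close> known candidates
  (which \<open>free_codes\<close> indexes) instead of \<open>n\<close>.\<close>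

definition paid :: "(nat \<Rightarrow> nat) \<Rightarrow> nat set set \<Rightarrow> nat set set" where
  "paid \<sigma> E = {e \<in> E. \<not> (\<exists>u\<in>common_nbs E e. \<forall>v\<in>e. \<sigma> u < \<sigma> v)}"

definition earlier_nbs :: "(nat \<Rightarrow> nat) \<Rightarrow> nat set set \<Rightarrow> nat \<Rightarrow> nat set" where
  "earlier_nbs \<sigma> E v = {u \<in> nbs E v. \<sigma> u < \<sigma> v}"

definition later_nbs :: "(nat \<Rightarrow> nat) \<Rightarrow> nat set set \<Rightarrow> nat \<Rightarrow> nat set" where
  "later_nbs \<sigma> E v = {w \<in> nbs E v. \<sigma> v < \<sigma> w}"

text \<open>The pair \<open>(i, j)\<close> names the \<open>j\<close>-th neighbour of the
  \<open>i\<close>-th earlier neighbour, so one bit per pair suffices. An index beyond the end of a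
  list selects an unspecified element; this is harmless, because decoding relies only on pairs in
  range.\<close>

definition free_codes :: "nat \<Rightarrow> (nat \<Rightarrow> nat) \<Rightarrow> nat set set \<Rightarrow> nat \<Rightarrow> (nat \<times> nat) set" where
  "free_codes d \<sigma> E v = {(i, j). i < d \<and> j < d \<and>
     sorted_list_of_set (nbs E (sorted_list_of_set (earlier_nbs \<sigma> E v) ! i)) ! j \<in> later_nbs \<sigma> E v}"

lemma sorted_list_of_set_nth_ex:
  assumes "finite A" "x \<in> A"
  obtains i where "i < card A" "sorted_list_of_set A ! i = x"
  using assms by (metis in_set_conv_nth length_sorted_list_of_set set_sorted_list_of_set)

text \<open>A later neighbour is found either through a paid edge, which \<open>E'\<close> shares,
  or through a code that both graphs read in the same already known neighbourhoods. Used in both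
  directions, the inclusion becomes an equality.\<close>

lemma later_nbs_decode:
  assumes E: "simple_graph n E" "regular d n E"
    and pd: "paid \<sigma> E \<subseteq> E'"
    and codes: "free_codes d \<sigma> E v \<subseteq> free_codes d \<sigma> E' v"
    and early: "earlier_nbs \<sigma> E v = earlier_nbs \<sigma> E' v"
    and nbs: "\<And>u. u \<in> earlier_nbs \<sigma> E v \<Longrightarrow> nbs E u = nbs E' u"
  shows "later_nbs \<sigma> E v \<subseteq> later_nbs \<sigma> E' v"
proof
  fix w assume w: "w \<in> later_nbs \<sigma> E v"
  then have vw: "{v, w} \<in> E" "\<sigma> v < \<sigma> w" by (auto simp: later_nbs_def nbs_def insert_commute)
  have vn: "v < n" using simple_graph_edge[OF E(1) vw(1)] by blast
  have deg: "card (nbs E u) = d" if "u < n" for u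
    using that E(2) by (simp add: regular_def degree_eq_card_nbs)
  note fin = finite_nbs[OF E(1)]
  show "w \<in> later_nbs \<sigma> E' v"
  proof (cases "{v, w} \<in> paid \<sigma> E")
    case True
    then show ?thesis using pd vw by (auto simp: later_nbs_def nbs_def insert_commute)
  next
    case False
    \<comment> \<open>An unpaid edge has a common neighbour \<open>u\<close> before both ends; thus
      \<open>u\<close> is an earlier neighbour of \<open>v\<close>, and \<open>w\<close> lies in its
      known neighbourhood.\<close>
    then obtain u where u: "u \<in> nbs E v" "u \<in> nbs E w" "\<sigma> u < \<sigma> v"
      using vw by (auto simp: paid_def common_nbs_pair)
    have un: "u < n" using nbs_subset[OF E(1)] u by blast
    have fe: "finite (earlier_nbs \<sigma> E v)" "card (earlier_nbs \<sigma> E v) \<le> d"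
      using fin[of v] deg[OF vn] card_mono[OF fin[of v], of "earlier_nbs \<sigma> E v"]
      by (auto simp: earlier_nbs_def)
    have ue: "u \<in> earlier_nbs \<sigma> E v" using u by (simp add: earlier_nbs_def)
    obtain i where i: "i < card (earlier_nbs \<sigma> E v)" "sorted_list_of_set (earlier_nbs \<sigma> E v) ! i = u"
      using sorted_list_of_set_nth_ex[OF fe(1) ue] by blast
    have "w \<in> nbs E u" using u nbs_sym by blast
    then obtain j where j: "j < card (nbs E u)" "sorted_list_of_set (nbs E u) ! j = w"
      using sorted_list_of_set_nth_ex[OF fin] by blast
    have "(i, j) \<in> free_codes d \<sigma> E v"
      using i j fe(2) deg[OF un] w by (auto simp: free_codes_def)
    then have "(i, j) \<in> free_codes d \<sigma> E' v" using codes by blast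
    then show ?thesis using i j nbs[OF ue] early by (simp add: free_codes_def)
  qed
qed

text \<open>Induction along the order. Neighbourhoods of earlier nodes agree, so by symmetry the
  earlier neighbours of \<open>v\<close> agree; decoding then gives the later ones. Injectivity of
  \<open>\<sigma>\<close> excludes ties.\<close>

lemma graph_code_inj:
  assumes E: "simple_graph n E" "regular d n E" and E': "simple_graph n E'" "regular d n E'"
    and \<sigma>: "inj_on \<sigma> {..<n}"
    and pd: "paid \<sigma> E = paid \<sigma> E'"
    and codes: "\<And>v. v < n \<Longrightarrow> free_codes d \<sigma> E v = free_codes d \<sigma> E' v"
  shows "E = E'"
proof (rule simple_graph_eqI[OF E(1) E'(1)])
  fix v assume "v < n"
  then show "nbs E v = nbs E' v"
  proof (induction "\<sigma> v" arbitrary: v rule: less_induct)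
    case less
    have early: "earlier_nbs \<sigma> E v = earlier_nbs \<sigma> E' v"
    proof -
      have "u \<in> nbs E v \<longleftrightarrow> u \<in> nbs E' v" if "\<sigma> u < \<sigma> v" for u
      proof (cases "u < n")
        case True
        then have "nbs E u = nbs E' u" using less that by blast
        then show ?thesis using nbs_sym by blast
      next
        case False
        then show ?thesis using nbs_subset[OF E(1), of v] nbs_subset[OF E'(1), of v] by auto
      qed
      then show ?thesis by (auto simp: earlier_nbs_def)
    qed
    have nb: "nbs E u = nbs E' u" if "u \<in> earlier_nbs \<sigma> E v" for u
      using that less nbs_subset[OF E(1), of v] by (auto simp: earlier_nbs_def)
    have "paid \<sigma> E \<subseteq> E'" "paid \<sigma> E' \<subseteq> E" using pd by (auto simp: paid_def)
    then have later: "later_nbs \<sigma> E v = later_nbs \<sigma> E' v"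
      using later_nbs_decode[OF E, of \<sigma> E' v] later_nbs_decode[OF E', of \<sigma> E v] codes less.prems nb early
      by (metis subset_antisym order_refl)
    have split: "nbs F v = earlier_nbs \<sigma> F v \<union> later_nbs \<sigma> F v" if F: "simple_graph n F" for F
    proof -
      have "\<sigma> u \<noteq> \<sigma> v" if "u \<in> nbs F v" for u
      proof -
        have "u < n" using nbs_subset[OF F] that by blast
        moreover have "u \<noteq> v" using notin_nbs_self[OF F] that by blast
        ultimately show ?thesis using \<sigma> less.prems by (auto dest: inj_onD)
      qed
      then show ?thesis by (force simp: earlier_nbs_def later_nbs_def)
    qed
    show ?case using split[OF E(1)] split[OF E'(1)] early later by simp
  qed
qed

section \<open>Weighted count of regular graphs for a fixed order\<close>

lemma sum_Pow_power_card:
  fixes x :: real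
  assumes "finite S"
  shows "(\<Sum>P\<in>Pow S. x ^ card P) = (1 + x) ^ card S"
  using prod_add[OF assms, of "\<lambda>_. x" "\<lambda>_. 1"] by (simp add: add.commute)

text \<open>By injectivity the sum is at most the sum over all pairs of an edge set and a family of
  codes. The weight \<open>1 / n\<close> per paid edge balances the number of possible edges, which
  is of order \<open>n\<^sup>2\<close>: the sum over edge sets is only exponential in
  \<open>n\<close>.\<close>

lemma sum_paid_weight_le:
  assumes \<sigma>: "inj_on \<sigma> {..<n}" and n: "n > 0"
  shows "(\<Sum>E | simple_graph n E \<and> regular d n E. (1 / real n) ^ card (paid \<sigma> E))
     \<le> (2 ^ (d * d)) ^ n * exp (real n)"
proof -
  let ?R = "{E. simple_graph n E \<and> regular d n E}"
  let ?S = "{e. e \<subseteq> {..<n} \<and> card e = 2}"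
  let ?F = "PiE {..<n} (\<lambda>_. Pow ({..<d} \<times> {..<d}))"
  let ?code = "\<lambda>E. (paid \<sigma> E, restrict (free_codes d \<sigma> E) {..<n})"
  have finS: "finite ?S" by (rule finite_subset[of _ "Pow {..<n}"]) auto
  have finF: "finite ?F" by (intro finite_PiE) auto
  have inj: "inj_on ?code ?R"
  proof (rule inj_onI)
    fix E E' assume E: "E \<in> ?R" "E' \<in> ?R" and eq: "?code E = ?code E'"
    have "free_codes d \<sigma> E v = free_codes d \<sigma> E' v" if "v < n" for v
    proof -
      have "restrict (free_codes d \<sigma> E) {..<n} = restrict (free_codes d \<sigma> E') {..<n}"
        using eq unfolding prod.inject by (rule conjunct2)
      from fun_cong[OF this, of v] show ?thesis using that by simp
    qed
    moreover have "paid \<sigma> E = paid \<sigma> E'"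
      using eq unfolding prod.inject by (rule conjunct1)
    ultimately show "E = E'" using E graph_code_inj[OF _ _ _ _ \<sigma>, of E d E'] by blast
  qed
  have sub: "?code ` ?R \<subseteq> Pow ?S \<times> ?F"
    by (auto simp: paid_def simple_graph_def free_codes_def)
  have "(\<Sum>E\<in>?R. (1 / real n) ^ card (paid \<sigma> E)) = (\<Sum>x\<in>?code ` ?R. (1 / real n) ^ card (fst x))"
    by (subst sum.reindex[OF inj]) simp
  also have "\<dots> \<le> (\<Sum>x\<in>Pow ?S \<times> ?F. (1 / real n) ^ card (fst x))"
    using finS finF sub by (intro sum_mono2) auto
  also have "\<dots> = (\<Sum>P\<in>Pow ?S. (1 / real n) ^ card P) * real (card ?F)"
    unfolding sum.cartesian_product' fst_conv sum_constant sum_distrib_right by (simp only: mult.commute)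
  also have "\<dots> = (1 + 1 / real n) ^ card ?S * (2 ^ (d * d)) ^ n"
    by (subst sum_Pow_power_card[OF finS]) (simp add: card_PiE card_Pow)
  also have "\<dots> \<le> exp (real n) * (2 ^ (d * d)) ^ n"
  proof (rule mult_right_mono)
    have "card ?S \<le> n * n"
      by (simp add: n_subsets choose_two)
        (metis div_le_dividend diff_le_self mult_le_mono2 order_trans)
    then have "(1 + 1 / real n) ^ card ?S \<le> (1 + 1 / real n) ^ (n * n)"
      by (intro power_increasing) auto
    also have "\<dots> \<le> exp (1 / real n) ^ (n * n)"
      by (intro power_mono exp_ge_add_one_self) auto
    also have "\<dots> = exp (real n)" using n by (simp add: exp_of_nat_mult[symmetric])
    finally show "(1 + 1 / real n) ^ card ?S \<le> exp (real n)" .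
  qed simp
  finally show ?thesis by (simp add: mult.commute)
qed

text \<open>Composing with a transposition shows that each element of \<open>S\<close> comes first equally often.\<close>

lemma card_permutations_argmin:
  assumes S: "S \<subseteq> {..<n}" and x: "x \<in> S"
  shows "card S * card {\<sigma>. \<sigma> permutes {..<n} \<and> (\<forall>y\<in>S - {x}. \<sigma> x < \<sigma> y)} = fact n"
proof -
  let ?M = "\<lambda>x. {\<sigma>. \<sigma> permutes {..<n} \<and> (\<forall>y\<in>S - {x}. \<sigma> x < (\<sigma> y :: nat))}"
  have finS: "finite S" using S finite_subset by blast
  have finP: "finite {\<sigma>. \<sigma> permutes {..<n}}" by (simp add: finite_permutations)
  have finM: "finite (?M y)" for y by (rule finite_subset[OF _ finP]) auto
  have le: "card (?M a) \<le> card (?M b)" if ab: "a \<in> S" "b \<in> S" for a b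
  proof (rule card_inj_on_le)
    show "inj_on (\<lambda>\<sigma>. \<sigma> \<circ> transpose a b) (?M a)"
      by (rule inj_onI) (metis (no_types, lifting) comp_assoc transpose_comp_involutory comp_id)
    have t: "transpose a b permutes {..<n}" using ab S by (intro permutes_swap_id) auto
    show "(\<lambda>\<sigma>. \<sigma> \<circ> transpose a b) ` ?M a \<subseteq> ?M b"
    proof (rule image_subsetI)
      fix \<sigma> assume \<sigma>: "\<sigma> \<in> ?M a"
      have "(\<sigma> \<circ> transpose a b) b < (\<sigma> \<circ> transpose a b) y" if "y \<in> S - {b}" for y
        using that ab \<sigma> by (cases "y = a") (auto simp: transpose_def)
      then show "\<sigma> \<circ> transpose a b \<in> ?M b"
        using permutes_compose[OF t] \<sigma> by blast
    qed
  qed (rule finM)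
  \<comment> \<open>Every order has exactly one first element in \<open>S\<close>, so these classes
    of equal size partition all \<open>n!\<close> permutations.\<close>
  have "(\<Union>y\<in>S. ?M y) = {\<sigma>. \<sigma> permutes {..<n}}"
  proof -
    have "\<exists>y\<in>S. \<sigma> \<in> ?M y" if \<sigma>: "\<sigma> permutes {..<n}" for \<sigma>
    proof -
      obtain y where y: "y \<in> S" "\<And>z. z \<in> S \<Longrightarrow> \<sigma> y \<le> \<sigma> z"
        using finS x by (metis arg_min_if_finite(1) arg_min_least empty_iff)
      have "\<sigma> y < \<sigma> z" if "z \<in> S - {y}" for z
        using y that permutes_inj[OF \<sigma>] by (metis DiffE injD insertI1 le_neq_implies_less)
      then show ?thesis using y \<sigma> by blast
    qed
    then show ?thesis by blast
  qed
  moreover have "card (\<Union>y\<in>S. ?M y) = (\<Sum>y\<in>S. card (?M y))"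
  proof (rule card_UN_disjoint[OF finS])
    show "\<forall>i\<in>S. \<forall>j\<in>S. i \<noteq> j \<longrightarrow> ?M i \<inter> ?M j = {}"
      by (auto dest: order.strict_trans)
  qed (use finM in blast)
  moreover have "(\<Sum>y\<in>S. card (?M y)) = (\<Sum>y\<in>S. card (?M x))"
    using le x by (intro sum.cong refl antisym) blast+
  ultimately show ?thesis by (simp add: card_permutations)
qed

text \<open>The edge is paid exactly when the first node among its ends and their common neighbours
  is an end. These are \<open>k + 2\<close> nodes for codegree \<open>k\<close>, each equally often
  first.\<close>

lemma card_permutations_paid:
  assumes E: "simple_graph n E" and e: "e \<in> E"
  shows "real (card {\<sigma>. \<sigma> permutes {..<n} \<and> e \<in> paid \<sigma> E})
     = fact n * (2 / (real (card (common_nbs E e)) + 2))"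
proof -
  let ?C = "common_nbs E e"
  let ?S = "e \<union> ?C"
  let ?M = "\<lambda>x. {\<sigma>. \<sigma> permutes {..<n} \<and> (\<forall>y\<in>?S - {x}. \<sigma> x < (\<sigma> y :: nat))}"
  obtain v w where vw: "e = {v, w}" "v \<noteq> w" "v < n" "w < n"
    using simple_graph_edgeE[OF E e] by blast
  have fin: "finite ?S" using common_nbs_finite[OF E e] vw by simp
  have disj: "e \<inter> ?C = {}" using notin_nbs_self[OF E] by (auto simp: vw common_nbs_pair)
  have S: "?S \<subseteq> {..<n}" using vw nbs_subset[OF E] by (auto simp: common_nbs_pair)
  have cS: "card ?S = card ?C + 2"
    using fin disj vw by (simp add: card_Un_disjoint del: Un_insert_left)
  have "{\<sigma>. \<sigma> permutes {..<n} \<and> e \<in> paid \<sigma> E} = ?M v \<union> ?M w"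
  proof (intro equalityI subsetI)
    fix \<sigma> assume \<sigma>: "\<sigma> \<in> {\<sigma>. \<sigma> permutes {..<n} \<and> e \<in> paid \<sigma> E}"
    then have p: "\<sigma> permutes {..<n}" and np: "\<not> (\<exists>u\<in>?C. \<forall>v\<in>e. \<sigma> u < \<sigma> v)" by (auto simp: paid_def)
    obtain y where y: "y \<in> ?S" "\<And>z. z \<in> ?S \<Longrightarrow> \<sigma> y \<le> \<sigma> z"
      using fin vw by (metis arg_min_if_finite(1) arg_min_least empty_iff insertI1 UnI1)
    have yl: "\<sigma> y < \<sigma> z" if "z \<in> ?S - {y}" for z
      using y that permutes_inj[OF p] by (metis DiffE injD insertI1 le_neq_implies_less)
    have "y \<in> e"
    proof (rule ccontr)
      assume "y \<notin> e"
      then have "\<forall>v\<in>e. \<sigma> y < \<sigma> v" using yl by blast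
      then show False using np y(1) \<open>y \<notin> e\<close> by blast
    qed
    then show "\<sigma> \<in> ?M v \<union> ?M w" using yl p vw(1) by auto
  next
    fix \<sigma> assume "\<sigma> \<in> ?M v \<union> ?M w"
    then obtain x where x: "x \<in> e" "\<sigma> \<in> ?M x" using vw(1) by blast
    have "\<not> (\<exists>u\<in>?C. \<forall>v\<in>e. \<sigma> u < \<sigma> v)"
    proof
      assume "\<exists>u\<in>?C. \<forall>v\<in>e. \<sigma> u < \<sigma> v"
      then obtain u where u: "u \<in> ?C" "\<sigma> u < \<sigma> x" using x by blast
      then have "u \<in> ?S - {x}" using x disj by auto
      then have "\<sigma> x < \<sigma> u" using x by blast
      then show False using u by simp
    qed
    then show "\<sigma> \<in> {\<sigma>. \<sigma> permutes {..<n} \<and> e \<in> paid \<sigma> E}"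
      using x e by (simp add: paid_def)
  qed
  moreover have "?M v \<inter> ?M w = {}"
  proof -
    have "\<sigma> v < \<sigma> w" "\<sigma> w < \<sigma> v" if "\<sigma> \<in> ?M v" "\<sigma> \<in> ?M w" for \<sigma>
      using that vw by blast+
    then show ?thesis by (meson disjoint_iff less_asym)
  qed
  moreover have "finite (?M x)" for x
    by (rule finite_subset[of _ "{\<sigma>. \<sigma> permutes {..<n}}"]) (auto simp: finite_permutations)
  ultimately have "card {\<sigma>. \<sigma> permutes {..<n} \<and> e \<in> paid \<sigma> E} = card (?M v) + card (?M w)"
    by (simp add: card_Un_disjoint)
  moreover have "real (card (?M x)) = fact n / (real (card ?C) + 2)" if "x \<in> e" for x
  proof -
    have "real (card ?S * card (?M x)) = real (fact n)"
      using card_permutations_argmin[OF S, of x] that by auto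
    then show ?thesis by (simp add: cS field_simps)
  qed
  ultimately have "real (card {\<sigma>. \<sigma> permutes {..<n} \<and> e \<in> paid \<sigma> E})
      = fact n / (real (card ?C) + 2) + fact n / (real (card ?C) + 2)"
    using vw(1) by (simp only: of_nat_add insertI1 insertI2)
  then show ?thesis by simp
qed

text \<open>Linearity of expectation for a uniformly random order, multiplied by
  \<open>n!\<close>.\<close>

lemma sum_card_paid:
  assumes E: "simple_graph n E"
  shows "(\<Sum>\<sigma> | \<sigma> permutes {..<n}. real (card (paid \<sigma> E)))
     = fact n * (\<Sum>e\<in>E. 2 / (real (card (common_nbs E e)) + 2))"
proof -
  have "{e \<in> E. e \<in> paid \<sigma> E} = paid \<sigma> E" for \<sigma> by (auto simp: paid_def)
  then have "(\<Sum>\<sigma> | \<sigma> permutes {..<n}. card (paid \<sigma> E))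
      = (\<Sum>e\<in>E. card {\<sigma> \<in> {\<sigma>. \<sigma> permutes {..<n}}. e \<in> paid \<sigma> E})"
    using sum_multicount_gen[of "{\<sigma>. \<sigma> permutes {..<n}}" E "\<lambda>\<sigma> e. e \<in> paid \<sigma> E"]
    by (simp add: simple_graph_finite[OF E] finite_permutations)
  then have "(\<Sum>\<sigma> | \<sigma> permutes {..<n}. real (card (paid \<sigma> E)))
      = (\<Sum>e\<in>E. real (card {\<sigma>. \<sigma> permutes {..<n} \<and> e \<in> paid \<sigma> E}))"
    by (simp flip: of_nat_sum)
  then show ?thesis using card_permutations_paid[OF E] by (simp add: sum_distrib_left)
qed

text \<open>Average the weighted count over all orders. A graph in \<open>X\<close> has at most
  \<open>A\<close> paid edges on average, so by convexity its mean weight is at least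
  \<open>n powr (- A)\<close>, while \<open>sum_paid_weight_le\<close> bounds the total weight for
  each order.\<close>

lemma card_graphs_le:
  assumes n: "n > 0"
    and X: "\<And>E. E \<in> X \<Longrightarrow> simple_graph n E \<and> regular d n E \<and>
          (\<Sum>e\<in>E. 2 / (real (card (common_nbs E e)) + 2)) \<le> A"
  shows "real (card X) \<le> exp (A * ln (real n)) * ((2 ^ (d * d)) ^ n * exp (real n))"
proof -
  let ?P = "{\<sigma>. \<sigma> permutes {..<n}}"
  let ?R = "{E. simple_graph n E \<and> regular d n E}"
  let ?B = "(2 ^ (d * d)) ^ n * exp (real n)"
  let ?L = "ln (real n)"
  have finP: "finite ?P" by (simp add: finite_permutations)
  have cardP: "real (card ?P) = fact n" by (simp add: card_permutations)
  have finR: "finite ?R" by (rule finite_subset[OF _ finite_simple_graphs[of n]]) auto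
  have XR: "X \<subseteq> ?R" using X by blast
  have L: "?L \<ge> 0" using n by simp
  have pw: "(1 / real n) ^ k = exp (- ?L * real k)" for k
    using n by (simp add: exp_minus exp_of_nat2_mult inverse_eq_divide power_one_over)
  have one: "fact n * exp (- A * ?L) \<le> (\<Sum>\<sigma>\<in>?P. (1 / real n) ^ card (paid \<sigma> E))" if "E \<in> X" for E
  proof -
    define \<mu> where "\<mu> = (\<Sum>e\<in>E. 2 / (real (card (common_nbs E e)) + 2))"
    have E: "simple_graph n E" and \<mu>: "\<mu> \<le> A" using X[OF that] by (auto simp: \<mu>_def)
    \<comment> \<open>Jensen's inequality for \<open>exp\<close>, from its tangent line at \<open>\<mu>\<close>\<close>
    have "(\<Sum>\<sigma>\<in>?P. 1 - ?L * (real (card (paid \<sigma> E)) - \<mu>)) = fact n"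
      using cardP sum_card_paid[OF E]
      by (simp add: sum_subtractf sum_distrib_left[symmetric] \<mu>_def)
    then have "fact n * exp (- \<mu> * ?L) = (\<Sum>\<sigma>\<in>?P. exp (- \<mu> * ?L) * (1 - ?L * (real (card (paid \<sigma> E)) - \<mu>)))"
      by (simp add: sum_distrib_left[symmetric])
    also have "\<dots> \<le> (\<Sum>\<sigma>\<in>?P. (1 / real n) ^ card (paid \<sigma> E))"
    proof (rule sum_mono)
      fix \<sigma>
      have "exp (- \<mu> * ?L) * (1 + - ?L * (real (card (paid \<sigma> E)) - \<mu>))
          \<le> exp (- \<mu> * ?L) * exp (- ?L * (real (card (paid \<sigma> E)) - \<mu>))"
        by (intro mult_left_mono exp_ge_add_one_self) simp
      also have "\<dots> = (1 / real n) ^ card (paid \<sigma> E)"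
        unfolding pw by (simp add: exp_add[symmetric] algebra_simps)
      finally show "exp (- \<mu> * ?L) * (1 - ?L * (real (card (paid \<sigma> E)) - \<mu>)) \<le> (1 / real n) ^ card (paid \<sigma> E)"
        by simp
    qed
    finally have "fact n * exp (- \<mu> * ?L) \<le> (\<Sum>\<sigma>\<in>?P. (1 / real n) ^ card (paid \<sigma> E))" .
    moreover have "exp (- A * ?L) \<le> exp (- \<mu> * ?L)" using \<mu> L by (simp add: mult_right_mono)
    ultimately show ?thesis by (meson fact_ge_zero mult_left_mono order_trans)
  qed
  have "real (card X) * (fact n * exp (- A * ?L)) = (\<Sum>E\<in>X. fact n * exp (- A * ?L))" by simp
  also have "\<dots> \<le> (\<Sum>E\<in>X. \<Sum>\<sigma>\<in>?P. (1 / real n) ^ card (paid \<sigma> E))"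
    by (intro sum_mono one)
  also have "\<dots> \<le> (\<Sum>E\<in>?R. \<Sum>\<sigma>\<in>?P. (1 / real n) ^ card (paid \<sigma> E))"
    by (intro sum_mono2 finR XR sum_nonneg) auto
  also have "\<dots> = (\<Sum>\<sigma>\<in>?P. \<Sum>E\<in>?R. (1 / real n) ^ card (paid \<sigma> E))" by (rule sum.swap)
  also have "\<dots> \<le> (\<Sum>\<sigma>\<in>?P. ?B)"
    by (intro sum_mono sum_paid_weight_le n) (auto intro: permutes_inj_on)
  also have "\<dots> = fact n * ?B" using cardP by simp
  finally have "fact n * (real (card X) * exp (- A * ?L)) \<le> fact n * ?B" by (simp add: algebra_simps)
  then have "real (card X) * exp (- A * ?L) \<le> ?B" by simp
  then have "exp (A * ?L) * (real (card X) * exp (- A * ?L)) \<le> exp (A * ?L) * ?B"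
    by (intro mult_left_mono) auto
  moreover have "exp (A * ?L) * (real (card X) * exp (- A * ?L)) = real (card X)"
    by (simp add: exp_minus field_simps)
  ultimately show ?thesis by (simp only:)
qed

section \<open>Many regular graphs with many triangles\<close>

definition regular_graphs :: "nat \<Rightarrow> nat \<Rightarrow> nat \<Rightarrow> nat set set set" where
  "regular_graphs d n t = {E. simple_graph n E \<and> regular d n E \<and> t \<le> card (triangles n E)}"

lemma finite_regular_graphs: "finite (regular_graphs d n t)"
  by (rule finite_subset[OF _ finite_simple_graphs[of n]]) (auto simp: regular_graphs_def)

section \<open>Disjoint unions of graphs\<close>

definition disjoint_union :: "nat \<Rightarrow> nat set set \<Rightarrow> nat set set \<Rightarrow> nat set set" where
  "disjoint_union a E F = E \<union> (`) ((+) a) ` F"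

lemma shifted_pair_iff: "{u, v} = (+) (a::nat) ` e \<longleftrightarrow> (\<exists>x y. u = a + x \<and> v = a + y \<and> e = {x, y})"
proof
  assume eq: "{u, v} = (+) a ` e"
  then obtain x y where "u = a + x" "v = a + y" by (metis imageE insertI1 insert_commute)
  moreover from this have "(+) a ` e = (+) a ` {x, y}" using eq by simp
  then have "e = {x, y}" by (metis inj_image_eq_iff inj_on_add)
  ultimately show "\<exists>x y. u = a + x \<and> v = a + y \<and> e = {x, y}" by blast
qed auto

lemma mem_disjoint_union_iff:
  "{u, v} \<in> disjoint_union a E F \<longleftrightarrow> {u, v} \<in> E \<or> (\<exists>x y. u = a + x \<and> v = a + y \<and> {x, y} \<in> F)"
  unfolding disjoint_union_def Un_iff image_iff shifted_pair_iff by blast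

lemma simple_graph_disjoint_union:
  assumes "simple_graph a E" "simple_graph b F"
  shows "simple_graph (a + b) (disjoint_union a E F)"
proof -
  have "e \<subseteq> {..<a + b} \<and> card e = 2" if "e \<in> E" for e
    using assms(1) that by (force simp: simple_graph_def)
  moreover have "(+) a ` e \<subseteq> {..<a + b} \<and> card ((+) a ` e) = 2" if "e \<in> F" for e
    using assms(2) that by (force simp: simple_graph_def card_image)
  ultimately show ?thesis by (auto simp: simple_graph_def disjoint_union_def)
qed

lemma regular_disjoint_union:
  assumes E: "simple_graph a E" "regular d a E" and F: "simple_graph b F" "regular d b F"
  shows "regular d (a + b) (disjoint_union a E F)"
  unfolding regular_def
proof (intro allI impI)
  fix v assume v: "v < a + b"
  show "degree (disjoint_union a E F) v = d"
  proof (cases "v < a")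
    case True
    then have "nbs (disjoint_union a E F) v = nbs E v"
      by (auto simp: nbs_def mem_disjoint_union_iff)
    then show ?thesis using E(2) True by (simp add: degree_eq_card_nbs regular_def)
  next
    case False
    then obtain w where w: "v = a + w" "w < b" using v by (metis le_Suc_ex nat_add_left_cancel_less not_less)
    have "\<not> {u, v} \<in> E" for u using simple_graph_edge(2)[OF E(1), of u v] False by blast
    then have "nbs (disjoint_union a E F) v = (+) a ` nbs F w"
      by (auto simp: nbs_def mem_disjoint_union_iff w)
    then show ?thesis using F(2) w(2) by (simp add: degree_eq_card_nbs regular_def card_image)
  qed
qed

lemma card_triangles_disjoint_union:
  "card (triangles a E) + card (triangles b F) \<le> card (triangles (a + b) (disjoint_union a E F))"
proof -
  let ?U = "(`) ((+) a) ` triangles b F"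
  have sub: "triangles a E \<union> ?U \<subseteq> triangles (a + b) (disjoint_union a E F)"
  proof -
    have "T \<in> triangles (a + b) (disjoint_union a E F)" if "T \<in> triangles a E" for T
      using that by (force simp: triangles_def is_clique_def mem_disjoint_union_iff)
    moreover have "(+) a ` T \<in> triangles (a + b) (disjoint_union a E F)" if "T \<in> triangles b F" for T
      using that by (force simp: triangles_def is_clique_def mem_disjoint_union_iff card_image)
    ultimately show ?thesis by blast
  qed
  have "triangles a E \<inter> ?U = {}"
  proof -
    have "False" if T: "T \<in> triangles a E" "T = (+) a ` S" for T S
    proof -
      have "T \<subseteq> {..<a}" "card T = 3" using T(1) by (auto simp: triangles_def is_clique_def)
      moreover from this T(2) have "T = {}" by auto
      ultimately show False by simp
    qed
    then show ?thesis by blast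
  qed
  then have "card (triangles a E) + card ?U = card (triangles a E \<union> ?U)"
    by (simp add: card_Un_disjoint finite_triangles)
  moreover have "card ?U = card (triangles b F)"
    by (rule card_image) (rule inj_onI, metis inj_image_eq_iff inj_on_add)
  ultimately show ?thesis using card_mono[OF finite_triangles sub] by simp
qed

text \<open>The union determines both parts: nodes below \<open>a\<close> see only \<open>E\<close>,
  the others only the shifted copy of \<open>F\<close>.\<close>

lemma card_regular_graphs_mult_le:
  "card (regular_graphs d a s) * card (regular_graphs d b t) \<le> card (regular_graphs d (a + b) (s + t))"
proof -
  let ?f = "\<lambda>(E, F). disjoint_union a E F"
  have "inj_on ?f (regular_graphs d a s \<times> regular_graphs d b t)"
  proof (rule inj_onI, clarify)
    fix E F E' F'
    assume "E \<in> regular_graphs d a s" "F \<in> regular_graphs d b t"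
      "E' \<in> regular_graphs d a s" "F' \<in> regular_graphs d b t"
      and eq: "disjoint_union a E F = disjoint_union a E' F'"
    then have s: "simple_graph a E" "simple_graph b F" "simple_graph a E'" "simple_graph b F'"
      by (auto simp: regular_graphs_def)
    have l: "nbs (disjoint_union a E F) v = nbs E v" if "v < a" for v E F
      using that by (auto simp: nbs_def mem_disjoint_union_iff)
    have r: "nbs (disjoint_union a E F) (a + w) = (+) a ` nbs F w" if E: "simple_graph a E" for w E F
    proof -
      have "\<not> {u, a + w} \<in> E" for u using simple_graph_edge(2)[OF E, of u "a + w"] by auto
      then show ?thesis by (auto simp: nbs_def mem_disjoint_union_iff)
    qed
    have "E = E'" by (rule simple_graph_eqI[OF s(1,3)]) (metis l eq)
    moreover have "F = F'"
    proof (rule simple_graph_eqI[OF s(2,4)])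
      fix v
      have "(+) a ` nbs F v = (+) a ` nbs F' v" using r s eq by metis
      then show "nbs F v = nbs F' v" by (metis inj_image_eq_iff inj_on_add)
    qed
    ultimately show "E = E' \<and> F = F'" by simp
  qed
  moreover have "?f ` (regular_graphs d a s \<times> regular_graphs d b t) \<subseteq> regular_graphs d (a + b) (s + t)"
  proof (clarify)
    fix E F assume "E \<in> regular_graphs d a s" "F \<in> regular_graphs d b t"
    then show "disjoint_union a E F \<in> regular_graphs d (a + b) (s + t)"
      using simple_graph_disjoint_union[of a E b F] regular_disjoint_union[of a E d b F]
        card_triangles_disjoint_union[of a E b F]
      by (auto simp: regular_graphs_def)
  qed
  ultimately show ?thesis
    using card_inj_on_le[OF _ _ finite_regular_graphs] by (metis card_cartesian_product)
qed

section \<open>Circulant graphs (Cayley graphs of the cyclic group) as regular graphs of every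
  admissible order\<close>

definition circulant :: "nat \<Rightarrow> nat set \<Rightarrow> nat set set" where
  "circulant N S = {{v, (v + k) mod N} | v k. v < N \<and> k \<in> S}"

lemma add_mod_inj_on: "inj_on (\<lambda>k. (v + k) mod N) {..<N::nat}"
proof (rule inj_onI)
  fix k l assume kl: "k \<in> {..<N}" "l \<in> {..<N}" "(v + k) mod N = (v + l) mod N"
  then have "k mod N = l mod N"
    using cong_add_lcancel_nat[of v k l N] unfolding Cong.cong_def by blast
  then show "k = l" using kl by simp
qed

text \<open>Seen from its other end, an edge with step \<open>k\<close> has step
  \<open>N - k\<close>, which also lies in \<open>S\<close>.\<close>

lemma nbs_circulant:
  assumes S: "S \<subseteq> {0<..<N}" and sym: "\<And>k. k \<in> S \<Longrightarrow> N - k \<in> S" and v: "v < N"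
  shows "nbs (circulant N S) v = (\<lambda>k. (v + k) mod N) ` S"
proof (intro equalityI subsetI)
  fix u assume "u \<in> nbs (circulant N S) v"
  then obtain v' k where k: "{u, v} = {v', (v' + k) mod N}" "v' < N" "k \<in> S"
    by (auto simp: nbs_def circulant_def)
  then consider "v' = v" "u = (v + k) mod N" | "v' = u" "v = (u + k) mod N"
    by (auto simp: doubleton_eq_iff)
  then show "u \<in> (\<lambda>k. (v + k) mod N) ` S"
  proof cases
    case 2
    have "k < N" using S k by auto
    then have "(v + (N - k)) mod N = (u + N) mod N"
      using 2 by (metis mod_add_left_eq add.assoc le_add_diff_inverse less_imp_le)
    then have "u = (v + (N - k)) mod N" using 2 k by simp
    then show ?thesis using sym[OF k(3)] by blast
  qed (use k in blast)
next
  fix u assume "u \<in> (\<lambda>k. (v + k) mod N) ` S"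
  then show "u \<in> nbs (circulant N S) v" using v by (auto simp: nbs_def circulant_def insert_commute)
qed

lemma circulant_regular:
  assumes S: "S \<subseteq> {0<..<N}" and sym: "\<And>k. k \<in> S \<Longrightarrow> N - k \<in> S" and N: "N > 0"
  shows "simple_graph N (circulant N S)" "regular (card S) N (circulant N S)"
proof -
  have "(v + k) mod N \<noteq> v" if "v < N" "k \<in> S" for v k
  proof
    assume "(v + k) mod N = v"
    then have "(v + k) mod N = (v + 0) mod N" using that by simp
    then have "k = 0" using inj_onD[OF add_mod_inj_on[of v N], of k 0] S N that by auto
    then show False using S that by auto
  qed
  then show "simple_graph N (circulant N S)"
    using N unfolding simple_graph_def circulant_def by (auto simp: card_insert_if) metis
  have "inj_on (\<lambda>k. (v + k) mod N) S" for v
    by (rule inj_on_subset[OF add_mod_inj_on]) (use S in auto)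
  then show "regular (card S) N (circulant N S)"
    by (simp add: regular_def degree_eq_card_nbs nbs_circulant[OF S sym] card_image)
qed

text \<open>Use the \<open>d div 2\<close> shortest steps in both directions. For odd
  \<open>d\<close> the parity condition makes \<open>N\<close> even, and the self-inverse step
  \<open>N / 2\<close> supplies the missing neighbour.\<close>

lemma regular_graph_exists:
  assumes "d < N" "even (d * N)"
  shows "card (regular_graphs d N 0) > 0"
proof -
  define k where "k = d div 2"
  let ?S0 = "{1..k} \<union> {N - k..<N}"
  have "\<exists>S. S \<subseteq> {0<..<N} \<and> (\<forall>k\<in>S. N - k \<in> S) \<and> card S = d"
  proof (cases "even d")
    case True
    then have d: "d = 2 * k" by (simp add: k_def)
    then have "card ?S0 = d" using assms by (subst card_Un_disjoint) auto
    moreover have "?S0 \<subseteq> {0<..<N}" "\<forall>k\<in>?S0. N - k \<in> ?S0" using assms d by auto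
    ultimately show ?thesis by blast
  next
    case False
    then have d: "d = 2 * k + 1" by (simp add: k_def)
    have "even N" using False assms by simp
    then obtain h where h: "N = 2 * h" by blast
    have kh: "k < h" using assms d h by simp
    have "card ?S0 = 2 * k" using kh h by (subst card_Un_disjoint) auto
    moreover have "h \<notin> ?S0" using kh h by auto
    ultimately have "card (insert h ?S0) = d" using d by simp
    moreover have "insert h ?S0 \<subseteq> {0<..<N}" "\<forall>k\<in>insert h ?S0. N - k \<in> insert h ?S0" using kh h by auto
    ultimately show ?thesis by blast
  qed
  then obtain S where "S \<subseteq> {0<..<N}" "\<And>k. k \<in> S \<Longrightarrow> N - k \<in> S" "card S = d" by blast
  then have "circulant N S \<in> regular_graphs d N 0"
    using circulant_regular[of S N] assms by (auto simp: regular_graphs_def)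
  then show ?thesis using finite_regular_graphs card_gt_0_iff by blast
qed

text \<open>A lift of the complete graph on \<open>{..d}\<close> with fibres \<open>{..<s}\<close>: independent matchings between
  the fibres give many regular graphs, and the trivial lifts, where the matchings
  compose, are disjoint unions of cliques.\<close>

definition lift_vertex :: "nat \<Rightarrow> nat \<Rightarrow> nat \<Rightarrow> nat" where
  "lift_vertex d i x = i + (d + 1) * x"

definition clique_lift :: "nat \<Rightarrow> nat \<Rightarrow> (nat \<Rightarrow> nat \<Rightarrow> nat \<Rightarrow> nat) \<Rightarrow> nat set set" where
  "clique_lift d s g = {{lift_vertex d i x, lift_vertex d j (g i j x)} | i j x.
     i \<le> d \<and> j \<le> d \<and> i \<noteq> j \<and> x < s}"

text \<open>The map \<open>g i j\<close> is the matching from fibre \<open>i\<close> to fibre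
  \<open>j\<close>. As opposite directions are mutually inverse, both listings of an edge agree and
  a node has just one neighbour in each other fibre.\<close>

definition lift_perms :: "nat \<Rightarrow> nat \<Rightarrow> (nat \<Rightarrow> nat \<Rightarrow> nat \<Rightarrow> nat) \<Rightarrow> bool" where
  "lift_perms d s g \<longleftrightarrow> (\<forall>i\<le>d. \<forall>j\<le>d. \<forall>x<s. i \<noteq> j \<longrightarrow> g i j x < s \<and> g j i (g i j x) = x)"

lemma lift_vertex_eq_iff:
  assumes "i \<le> d" "j \<le> d"
  shows "lift_vertex d i x = lift_vertex d j y \<longleftrightarrow> i = j \<and> x = y"
proof
  assume eq: "lift_vertex d i x = lift_vertex d j y"
  have "lift_vertex d i x mod (d + 1) = i" "lift_vertex d j y mod (d + 1) = j"
    using assms by (simp_all only: lift_vertex_def mod_mult_self2) simp_all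
  then have "i = j" using eq by simp
  moreover from this have "(d + 1) * x = (d + 1) * y"
    using eq by (simp only: lift_vertex_def add_left_cancel)
  then have "x = y" by (simp only: mult_cancel1) simp
  ultimately show "i = j \<and> x = y" by simp
qed simp

lemma lift_vertex_less:
  assumes "i \<le> d" "x < s"
  shows "lift_vertex d i x < (d + 1) * s"
proof -
  have "lift_vertex d i x < (d + 1) * (x + 1)" using assms by (simp add: lift_vertex_def)
  also have "\<dots> \<le> (d + 1) * s" using assms by (intro mult_le_mono2) simp
  finally show ?thesis .
qed

lemma lift_vertexE:
  assumes "v < (d + 1) * s"
  obtains i x where "i \<le> d" "x < s" "v = lift_vertex d i x"
proof
  show "v mod (d + 1) \<le> d" by (metis Suc_eq_plus1 less_Suc_eq_le mod_less_divisor zero_less_Suc)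
  show "v div (d + 1) < s" using assms by (metis less_mult_imp_div_less mult.commute)
  show "v = lift_vertex d (v mod (d + 1)) (v div (d + 1))" unfolding lift_vertex_def by (metis mod_mult_div_eq)
qed

lemma nbs_clique_lift:
  assumes g: "lift_perms d s g" and i: "i \<le> d" and x: "x < s"
  shows "nbs (clique_lift d s g) (lift_vertex d i x) = (\<lambda>j. lift_vertex d j (g i j x)) ` ({..d} - {i})"
proof (intro equalityI subsetI)
  fix u assume "u \<in> nbs (clique_lift d s g) (lift_vertex d i x)"
  then obtain a b y where e: "{u, lift_vertex d i x} = {lift_vertex d a y, lift_vertex d b (g a b y)}"
      and ab: "a \<le> d" "b \<le> d" "a \<noteq> b" "y < s"
    by (auto simp: nbs_def clique_lift_def)
  then consider "u = lift_vertex d b (g a b y)" "lift_vertex d i x = lift_vertex d a y"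
      | "u = lift_vertex d a y" "lift_vertex d i x = lift_vertex d b (g a b y)"
    by (auto simp: doubleton_eq_iff)
  then show "u \<in> (\<lambda>j. lift_vertex d j (g i j x)) ` ({..d} - {i})"
  proof cases
    case 1
    then show ?thesis using ab i by (auto simp: lift_vertex_eq_iff)
  next
    case 2
    then have "b = i" "x = g a b y" using ab i by (auto simp: lift_vertex_eq_iff)
    moreover from this have "g i a x = y" using g ab by (auto simp: lift_perms_def)
    ultimately show ?thesis using 2 ab by (intro image_eqI[of _ _ a]) auto
  qed
next
  fix u assume "u \<in> (\<lambda>j. lift_vertex d j (g i j x)) ` ({..d} - {i})"
  then obtain j where "j \<le> d" "i \<noteq> j" "u = lift_vertex d j (g i j x)" by auto
  then have "{lift_vertex d i x, u} \<in> clique_lift d s g" using i x by (auto simp: clique_lift_def)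
  then show "u \<in> nbs (clique_lift d s g) (lift_vertex d i x)" by (simp add: nbs_def insert_commute)
qed

lemma clique_lift_regular:
  assumes g: "lift_perms d s g"
  shows "simple_graph ((d + 1) * s) (clique_lift d s g)" "regular d ((d + 1) * s) (clique_lift d s g)"
proof -
  show "simple_graph ((d + 1) * s) (clique_lift d s g)"
    unfolding simple_graph_def
  proof
    fix e assume "e \<in> clique_lift d s g"
    then obtain i j x where e: "e = {lift_vertex d i x, lift_vertex d j (g i j x)}"
       "i \<le> d" "j \<le> d" "i \<noteq> j" "x < s" by (auto simp: clique_lift_def)
    moreover have "g i j x < s" using e g by (simp add: lift_perms_def)
    ultimately show "e \<subseteq> {..<(d + 1) * s} \<and> card e = 2"
      using lift_vertex_less[of i d x s] lift_vertex_less[of j d "g i j x" s]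
      by (simp add: card_2_iff lift_vertex_eq_iff)
  qed
  show "regular d ((d + 1) * s) (clique_lift d s g)"
    unfolding regular_def
  proof (intro allI impI)
    fix v assume "v < (d + 1) * s"
    then obtain i x where v: "i \<le> d" "x < s" "v = lift_vertex d i x" by (rule lift_vertexE)
    have "inj_on (\<lambda>j. lift_vertex d j (g i j x)) ({..d} - {i})"
      by (rule inj_onI) (auto simp: lift_vertex_eq_iff)
    then show "degree (clique_lift d s g) v = d"
      using v by (simp add: degree_eq_card_nbs nbs_clique_lift[OF g] card_image)
  qed
qed

text \<open>The matching can be read off the graph: \<open>g i j x\<close> gives the only neighbour
  in fibre \<open>j\<close> of the node at position \<open>x\<close> of fibre
  \<open>i\<close>.\<close>

lemma clique_lift_eqD:
  assumes g: "lift_perms d s g" and h: "lift_perms d s h" and eq: "clique_lift d s g = clique_lift d s h"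
    and ij: "i \<le> d" "j \<le> d" "i \<noteq> j" "x < s"
  shows "g i j x = h i j x"
proof -
  have "lift_vertex d j (g i j x) \<in> (\<lambda>j. lift_vertex d j (h i j x)) ` ({..d} - {i})"
    using nbs_clique_lift[OF g ij(1,4)] nbs_clique_lift[OF h ij(1,4)] eq ij by auto
  then show ?thesis using ij by (auto simp: lift_vertex_eq_iff)
qed

section \<open>Counting the lifts\<close>

lemma card_permutation_families:
  assumes "finite I"
  shows "card (PiE I (\<lambda>_. {\<sigma>. \<sigma> permutes {..<s::nat}})) = fact s ^ card I"
  using assms by (simp add: card_PiE card_permutations)

lemma permutation_family_eqI:
  assumes "\<phi> \<in> PiE I (\<lambda>_. {\<sigma>. \<sigma> permutes {..<s::nat}})" "\<psi> \<in> PiE I (\<lambda>_. {\<sigma>. \<sigma> permutes {..<s}})"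
    and "\<And>i x. i \<in> I \<Longrightarrow> x < s \<Longrightarrow> \<phi> i x = \<psi> i x"
  shows "\<phi> = \<psi>"
proof (rule PiE_ext[OF assms(1,2)])
  fix i assume i: "i \<in> I"
  then have "\<phi> i permutes {..<s}" "\<psi> i permutes {..<s}" using assms(1,2) by (auto dest: PiE_mem)
  then show "\<phi> i = \<psi> i" using assms(3)[OF i] by (metis ext lessThan_iff permutes_not_in)
qed

lemma permutes_lessThan_less: "\<sigma> permutes {..<s::nat} \<Longrightarrow> x < s \<Longrightarrow> \<sigma> x < s"
  by (metis lessThan_iff permutes_in_image)

text \<open>One free permutation for each pair of fibres, with its inverse for the reverse
  direction. With \<open>n = (d + 1) * p\<close> this is \<open>n powr (d n / 2)\<close> up to
  exponential factors.\<close>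

lemma card_regular_graphs_ge:
  "fact p ^ (d * (d + 1) div 2) \<le> card (regular_graphs d ((d + 1) * p) 0)"
proof -
  let ?I = "Sigma {..d} (\<lambda>j. {..<j})"
  let ?\<Phi> = "PiE ?I (\<lambda>_. {\<sigma>. \<sigma> permutes {..<p}})"
  define g where "g = (\<lambda>\<phi> i j. if i < j then \<phi> (j, i) else inv (\<phi> (i, j :: nat)) :: nat \<Rightarrow> nat)"
  have lp: "lift_perms d p (g \<phi>)" if \<phi>: "\<phi> \<in> ?\<Phi>" for \<phi>
    unfolding lift_perms_def
  proof (intro allI impI)
    fix i j x assume ij: "i \<le> d" "j \<le> d" "x < p" "i \<noteq> j"
    have perm: "\<phi> (b, a) permutes {..<p}" if "a < b" "b \<le> d" for a b
      using PiE_mem[OF \<phi>, of "(b, a)"] that by auto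
    show "g \<phi> i j x < p \<and> g \<phi> j i (g \<phi> i j x) = x"
    proof (cases "i < j")
      case True
      then show ?thesis using perm[of i j] ij
        by (simp add: g_def permutes_inverses permutes_lessThan_less)
    next
      case False
      then show ?thesis using perm[of j i] ij
        by (simp add: g_def permutes_inverses permutes_lessThan_less permutes_inv)
    qed
  qed
  have "inj_on (\<lambda>\<phi>. clique_lift d p (g \<phi>)) ?\<Phi>"
  proof (rule inj_onI)
    fix \<phi> \<psi> assume ab: "\<phi> \<in> ?\<Phi>" "\<psi> \<in> ?\<Phi>" and eq: "clique_lift d p (g \<phi>) = clique_lift d p (g \<psi>)"
    show "\<phi> = \<psi>"
    proof (rule permutation_family_eqI[OF ab])
      fix k x assume k: "k \<in> ?I" "x < p"
      then obtain i j where "k = (j, i)" "i < j" "j \<le> d" by auto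
      then show "\<phi> k x = \<psi> k x"
        using clique_lift_eqD[OF lp[OF ab(1)] lp[OF ab(2)] eq, of i j x] k by (simp add: g_def)
    qed
  qed
  moreover have "(\<lambda>\<phi>. clique_lift d p (g \<phi>)) ` ?\<Phi> \<subseteq> regular_graphs d ((d + 1) * p) 0"
    using clique_lift_regular[OF lp] by (auto simp: regular_graphs_def)
  ultimately have "card ?\<Phi> \<le> card (regular_graphs d ((d + 1) * p) 0)"
    by (rule card_inj_on_le[OF _ _ finite_regular_graphs])
  moreover have "card ?I = d * (d + 1) div 2"
    using gauss_sum_nat[of d] by (simp add: atLeast0AtMost)
  ultimately show ?thesis by (simp add: card_permutation_families)
qed

text \<open>Give each fibre a permutation \<open>s \<phi> i\<close> from clique labels to positions,
  and match positions with equal labels. The nodes with a fixed label then form a clique, with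
  \<open>(d + 1) choose 3\<close> triangles.\<close>

lemma card_clique_graphs_ge:
  "fact m ^ d \<le> card (regular_graphs d ((d + 1) * m) (m * ((d + 1) choose 3)))"
proof -
  let ?\<Phi> = "PiE {1..d} (\<lambda>_. {\<sigma>. \<sigma> permutes {..<m}})"
  \<comment> \<open>The identity on fibre \<open>0\<close> ties the clique labels to its positions,
    so the other permutations are the matchings from fibre \<open>0\<close> and can be recovered
    from the graph.\<close>
  define s where "s = (\<lambda>\<phi> i. if i = 0 then id else \<phi> (i :: nat) :: nat \<Rightarrow> nat)"
  define g where "g = (\<lambda>\<phi> i j. s \<phi> j \<circ> inv (s \<phi> i))"
  have sp: "s \<phi> i permutes {..<m}" if "\<phi> \<in> ?\<Phi>" "i \<le> d" for \<phi> i
    using PiE_mem[OF that(1), of i] that(2) by (auto simp: s_def permutes_id)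
  have lp: "lift_perms d m (g \<phi>)" if \<phi>: "\<phi> \<in> ?\<Phi>" for \<phi>
    unfolding lift_perms_def
  proof (intro allI impI)
    fix i j x assume ij: "i \<le> d" "j \<le> d" "x < m" "i \<noteq> j"
    show "g \<phi> i j x < m \<and> g \<phi> j i (g \<phi> i j x) = x"
      using sp[OF \<phi> ij(1)] sp[OF \<phi> ij(2)] ij
      by (simp add: g_def permutes_inverses permutes_lessThan_less permutes_inv)
  qed
  have "inj_on (\<lambda>\<phi>. clique_lift d m (g \<phi>)) ?\<Phi>"
  proof (rule inj_onI)
    fix \<phi> \<psi> assume ab: "\<phi> \<in> ?\<Phi>" "\<psi> \<in> ?\<Phi>" and eq: "clique_lift d m (g \<phi>) = clique_lift d m (g \<psi>)"
    show "\<phi> = \<psi>"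
    proof (rule permutation_family_eqI[OF ab])
      fix k x assume k: "k \<in> {1..d}" "x < m"
      then show "\<phi> k x = \<psi> k x"
        using clique_lift_eqD[OF lp[OF ab(1)] lp[OF ab(2)] eq, of 0 k x] by (simp add: g_def s_def)
    qed
  qed
  moreover have "clique_lift d m (g \<phi>) \<in> regular_graphs d ((d + 1) * m) (m * ((d + 1) choose 3))"
    if \<phi>: "\<phi> \<in> ?\<Phi>" for \<phi>
  proof -
    let ?E = "clique_lift d m (g \<phi>)"
    \<comment> \<open>A pair of a clique label and three fibres stands for one triangle.\<close>
    let ?K = "{..<m} \<times> {I. I \<subseteq> {..d} \<and> card I = 3}"
    let ?f = "\<lambda>(x, I). (\<lambda>i. lift_vertex d i (s \<phi> i x)) ` I"
    have "inj_on ?f ?K"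
    proof (rule inj_onI, clarify)
      fix x I y J
      assume I: "I \<subseteq> {..d}" "card I = 3" and J: "J \<subseteq> {..d}" "card J = 3"
        and eq: "(\<lambda>i. lift_vertex d i (s \<phi> i x)) ` I = (\<lambda>i. lift_vertex d i (s \<phi> i y)) ` J"
      \<comment> \<open>One node suffices: it reveals its fibre, and by injectivity of that fibre's
        permutation also its label.\<close>
      have *: "j \<in> B \<and> u = w"
        if "A \<subseteq> {..d}" "B \<subseteq> {..d}" "j \<in> A"
          "(\<lambda>i. lift_vertex d i (s \<phi> i u)) ` A = (\<lambda>i. lift_vertex d i (s \<phi> i w)) ` B" for A B j u w
      proof -
        have "lift_vertex d j (s \<phi> j u) \<in> (\<lambda>i. lift_vertex d i (s \<phi> i w)) ` B"
          using imageI[OF that(3), of "\<lambda>i. lift_vertex d i (s \<phi> i u)"] that(4) by simp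
        then obtain i where i: "i \<in> B" "lift_vertex d j (s \<phi> j u) = lift_vertex d i (s \<phi> i w)"
          by blast
        moreover have "i \<le> d" "j \<le> d" using i that by auto
        ultimately have "i = j" "s \<phi> j u = s \<phi> j w" by (auto simp: lift_vertex_eq_iff)
        then show ?thesis using i permutes_inj[OF sp[OF \<phi> \<open>j \<le> d\<close>]] by (auto dest: injD)
      qed
      have "I = J" using *[OF I(1) J(1) _ eq] *[OF J(1) I(1) _ eq[symmetric]] by blast
      moreover obtain i where "i \<in> I" using I by fastforce
      ultimately show "x = y \<and> I = J" using *[OF I(1) J(1) _ eq] by blast
    qed
    moreover have "?f ` ?K \<subseteq> triangles ((d + 1) * m) ?E"
    proof (clarify)
      fix x I assume x: "x < m" and I: "I \<subseteq> {..d}" "card I = 3"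
      let ?T = "(\<lambda>i. lift_vertex d i (s \<phi> i x)) ` I"
      have xs: "s \<phi> i x < m" if "i \<in> I" for i
        using that I x sp[OF \<phi>] permutes_lessThan_less by blast
      have "{lift_vertex d i (s \<phi> i x), lift_vertex d j (s \<phi> j x)} \<in> ?E" if "i \<in> I" "j \<in> I" "i \<noteq> j" for i j
      proof -
        have "g \<phi> i j (s \<phi> i x) = s \<phi> j x"
          using sp[OF \<phi>, of i] that I by (auto simp: g_def permutes_inverses)
        moreover have "i \<le> d" "j \<le> d" using that I by auto
        ultimately show ?thesis using that xs[of i] unfolding clique_lift_def mem_Collect_eq
          by (intro exI[of _ i] exI[of _ j] exI[of _ "s \<phi> i x"]) simp
      qed
      then have "is_clique ((d + 1) * m) ?E ?T"
        using xs I lift_vertex_less by (auto simp: is_clique_def)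
      moreover have "card ?T = 3"
      proof (subst card_image)
        show "inj_on (\<lambda>i. lift_vertex d i (s \<phi> i x)) I"
          by (rule inj_onI) (use I lift_vertex_eq_iff in blast)
      qed (use I in simp)
      ultimately show "?T \<in> triangles ((d + 1) * m) ?E" by (simp add: triangles_def)
    qed
    ultimately have "card ?K \<le> card (triangles ((d + 1) * m) ?E)"
      by (rule card_inj_on_le[OF _ _ finite_triangles])
    moreover have "card ?K = m * ((d + 1) choose 3)"
      by (simp add: card_cartesian_product n_subsets)
    ultimately show ?thesis using clique_lift_regular[OF lp[OF \<phi>]] by (simp add: regular_graphs_def)
  qed
  ultimately have "card ?\<Phi> \<le> card (regular_graphs d ((d + 1) * m) (m * ((d + 1) choose 3)))"
    using card_inj_on_le[OF _ _ finite_regular_graphs] by (metis (no_types, lifting) image_subsetI)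
  then show ?thesis by (simp add: card_permutation_families)
qed

section \<open>Comparison of the two counts\<close>

text \<open>A clique on \<open>d + 1\<close> nodes through \<open>v\<close> is \<open>v\<close> with
  all its neighbours, hence contains every triangle at \<open>v\<close>. So a triangle outside such
  cliques has a bad node, and it is that node together with one of the \<open>2 ^ d\<close> subsets
  of its neighbourhood.\<close>

lemma card_nonclique_triangles_le:
  assumes E: "simple_graph n E" "regular d n E"
  shows "card (nonclique_triangles d n E) \<le> 2 ^ d * card (bad_nodes d n E)"
proof -
  have finb: "finite (bad_nodes d n E)" by (simp add: bad_nodes_def)
  have deg: "card (nbs E v) = d" if "v < n" for v
    using that E(2) by (simp add: regular_def degree_eq_card_nbs)
  note fin = finite_nbs[OF E(1)]
  have clique_sub: "K \<subseteq> insert v (nbs E v)" if "is_clique n E K" "v \<in> K" for K v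
    using that by (auto simp: is_clique_def nbs_def)
  have "nonclique_triangles d n E \<subseteq> (\<Union>v\<in>bad_nodes d n E. insert v ` Pow (nbs E v))"
  proof
    fix T assume "T \<in> nonclique_triangles d n E"
    then have T: "T \<in> triangles n E" "is_clique n E T" "card T = 3"
      and ncl: "\<And>K. is_clique n E K \<Longrightarrow> card K = d + 1 \<Longrightarrow> \<not> T \<subseteq> K"
      by (auto simp: nonclique_triangles_def triangles_def)
    obtain v where v: "v \<in> T" using T(3) by fastforce
    have vn: "v < n" using T(2) v by (auto simp: is_clique_def)
    have Tn: "T \<subseteq> insert v (nbs E v)" using clique_sub T v by blast
    have False if K: "is_clique n E K" "card K = d + 1" "v \<in> K" for K
    proof -
      have "card (insert v (nbs E v)) = card K"
        using K(2) fin deg[OF vn] notin_nbs_self[OF E(1)] by simp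
      then have "K = insert v (nbs E v)"
        using clique_sub[OF K(1,3)] fin by (intro card_subset_eq) auto
      then show False using ncl[OF K(1,2)] Tn by blast
    qed
    then have "v \<in> bad_nodes d n E" using vn T(1) v unfolding bad_nodes_def by blast
    moreover have "T = insert v (T - {v})" "T - {v} \<in> Pow (nbs E v)" using v Tn by auto
    ultimately show "T \<in> (\<Union>v\<in>bad_nodes d n E. insert v ` Pow (nbs E v))" by blast
  qed
  then have "card (nonclique_triangles d n E) \<le> card (\<Union>v\<in>bad_nodes d n E. insert v ` Pow (nbs E v))"
    using finb fin by (intro card_mono) auto
  also have "\<dots> \<le> (\<Sum>v\<in>bad_nodes d n E. card (insert v ` Pow (nbs E v)))"
    by (rule card_UN_le[OF finb])
  also have "\<dots> \<le> (\<Sum>v\<in>bad_nodes d n E. 2 ^ d)"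
  proof (rule sum_mono)
    fix v assume "v \<in> bad_nodes d n E"
    then have "card (nbs E v) = d" using deg by (simp add: bad_nodes_def)
    then show "card (insert v ` Pow (nbs E v)) \<le> 2 ^ d"
      using card_image_le[of "Pow (nbs E v)" "insert v"] fin by (simp add: card_Pow)
  qed
  finally show ?thesis by (simp add: mult.commute)
qed

section \<open>Lower bound for the size of the class\<close>

text \<open>The bound \<open>(k / e) ^ k\<close>, with \<open>k\<close> replaced by the smaller
  \<open>\<kappa> x\<close> in the logarithm: factorials of different numbers proportional to
  \<open>n\<close> can all be written with \<open>ln n\<close>, at exponential loss.\<close>

lemma fact_ge_exp:
  assumes "0 < \<kappa>" "\<kappa> * x \<le> real k" "0 < x"
  shows "fact k \<ge> exp (real k * (ln x - (1 - ln \<kappa>)))"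
proof -
  have k: "0 < real k" using assms by (smt (verit) mult_pos_pos)
  have "ln x + ln \<kappa> \<le> ln (real k)" using assms k by (simp add: ln_mult_pos[symmetric] mult.commute)
  then have "exp (real k * (ln x - (1 - ln \<kappa>))) \<le> exp (real k * (ln (real k) - 1))"
    using k by simp
  also have "\<dots> = real k ^ k / exp (real k)"
    using k by (simp add: right_diff_distrib exp_diff exp_of_nat_mult)
  also have "\<dots> \<le> fact k"
  proof -
    \<comment> \<open>A single term of the exponential series at \<open>k\<close>.\<close>
    have "sum (\<lambda>n. real k ^ n /\<^sub>R fact n) {k} \<le> (\<Sum>n. real k ^ n /\<^sub>R fact n)"
      by (rule sum_le_suminf[OF summable_exp_generic]) auto
    then have "real k ^ k / fact k \<le> exp (real k)" by (simp add: exp_def field_simps)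
    then show ?thesis by (simp add: field_simps)
  qed
  finally show ?thesis .
qed

text \<open>Up to factors exponential in \<open>n\<close>, the size of \<open>G_dc d c n\<close> is
  \<open>n powr (entropy_rate d c * n)\<close>.\<close>

definition entropy_rate :: "nat \<Rightarrow> real \<Rightarrow> real" where
  "entropy_rate d c = real d / 2 - c * (real d * (real d - 1)) / (2 * (real d + 1))"

lemma real_choose_two: "real (d choose 2) = real d * (real d - 1) / 2"
proof -
  have "even (d * (d - 1))" by auto
  then have "2 * (d choose 2) = d * (d - 1)" unfolding choose_two by (rule dvd_mult_div_cancel)
  then have "2 * real (d choose 2) = real (d * (d - 1))" by (metis of_nat_mult of_nat_numeral)
  then show ?thesis by (cases d) (auto simp: algebra_simps)
qed

lemma G_dc_even:
  assumes "G_dc d c n \<noteq> {}"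
  shows "even (d * n)"
proof -
  obtain E where "simple_graph n E" "regular d n E" using assms by (auto simp: G_dc_def)
  then have "n * d = 2 * card E" using handshake[of n E] by (simp add: regular_def)
  then show ?thesis by (metis dvd_triv_left mult.commute)
qed

lemma finite_G_dc: "finite (G_dc d c n)"
  by (rule finite_subset[OF _ finite_simple_graphs[of n]]) (auto simp: G_dc_def)

text \<open>A clique on \<open>d + 1\<close> nodes has as many triangles per node as
  \<open>T_max\<close> allows, so \<open>m\<close> cliques covering at least \<open>c n\<close>
  nodes reach the threshold.\<close>

lemma regular_graphs_subset_G_dc:
  assumes "c * real n \<le> real ((d + 1) * m)" "t \<ge> m * ((d + 1) choose 3)"
  shows "regular_graphs d n t \<subseteq> G_dc d c n"
proof -
  have "3 * ((d + 1) choose 3) = (d + 1) * (d choose 2)"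
    using Suc_times_binomial[of 2 d] by (simp add: numeral_3_eq_3 numeral_2_eq_2)
  then have ch: "3 * real ((d + 1) choose 3) = real (d + 1) * real (d choose 2)"
    by (metis of_nat_mult of_nat_numeral)
  have "c * T_max d n = (c * real n) * (real (d choose 2) / 3)" by (simp add: T_max_def)
  also have "\<dots> \<le> real ((d + 1) * m) * (real (d choose 2) / 3)"
    using assms by (intro mult_right_mono) auto
  also have "\<dots> = real (m * ((d + 1) choose 3))" using ch by (simp add: algebra_simps)
  also have "\<dots> \<le> real t" using assms(2) by (simp only: of_nat_le_iff)
  finally show ?thesis by (auto simp: regular_graphs_def G_dc_def)
qed

text \<open>Split the nodes into \<open>m\<close> cliques on about \<open>c n\<close> nodes, a lift
  with fibres of size \<open>p\<close>, and a remainder of bounded size \<open>r\<close> carrying a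
  circulant graph.\<close>

lemma card_G_dc_ge:
  assumes c: "0 < c" "c < 1"
  obtains M K :: real and N :: nat where
    "\<And>n. n \<ge> N \<Longrightarrow> even (d * n) \<Longrightarrow>
       exp ((entropy_rate d c * real n - M) * ln (real n) - K * real n) \<le> real (card (G_dc d c n))"
proof
  define q where "q = d + 1"
  \<comment> \<open>Chosen so that both \<open>m\<close> and \<open>p\<close> are at least
    \<open>\<kappa> n\<close>.\<close>
  define \<kappa> where "\<kappa> = min c ((1 - c) / 2) / real q"
  \<comment> \<open>The first term pays for rounding \<open>m\<close> up, the second for a remainder
    of up to \<open>2 d + 1\<close> nodes.\<close>
  define M where "M = real d * (real d - 1) / 2 + real d * (2 * real d + 1) / 2"
  define K where "K = (1 - ln \<kappa>) * real d"
  \<comment> \<open>Rounding \<open>m\<close> and the remainder use at most \<open>3 q\<close> nodes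
    beyond \<open>c n\<close>. From \<open>N\<close> on this is at most half of
    \<open>(1 - c) n\<close>, and the lift keeps the other half.\<close>
  define N where "N = nat \<lceil>6 * real q / (1 - c)\<rceil> + 1"
  have q: "q > 0" by (simp add: q_def)
  have \<kappa>: "0 < \<kappa>" "\<kappa> \<le> 1" using c q by (auto simp: \<kappa>_def divide_simps)
  fix n assume n: "n \<ge> N" and ev: "even (d * n)"
  define m where "m = nat \<lceil>c * real n / real q\<rceil>"
  \<comment> \<open>One block of \<open>q\<close> nodes moves from the lift to the remainder, so
    that \<open>d < r\<close> and a \<open>d\<close>-regular circulant graph on \<open>r\<close>
    nodes is possible.\<close>
  define p where "p = (n - q * m) div q - 1"
  define r where "r = (n - q * m) mod q + q"
  have n0: "n > 0" using n by (simp add: N_def)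
  have big: "6 * real q \<le> (1 - c) * real n"
  proof -
    have "6 * real q / (1 - c) \<le> real N" unfolding N_def by linarith
    also have "\<dots> \<le> real n" using n by simp
    finally show ?thesis using c by (simp add: field_simps)
  qed
  have "real m \<ge> c * real n / real q" "real m \<le> c * real n / real q + 1"
    unfolding m_def using c q by (auto simp: of_nat_ceiling intro: order_trans[OF of_nat_ceiling])
  then have m: "c * real n \<le> real q * real m" "real q * real m \<le> c * real n + real q"
    using q by (simp_all add: field_simps)
  have qm: "real (q * m) + 2 * real q \<le> real n"
    using m(2) big by (simp add: algebra_simps)
  then have qm': "q * m + 2 * q \<le> n" by linarith
  then have "(n - q * m) div q \<ge> 2" using q by (simp add: less_eq_div_iff_mult_less_eq)
  then have "(n - q * m) div q = p + 1" by (simp add: p_def)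
  then have "n - q * m = q * (p + 1) + (n - q * m) mod q" by (metis mult_div_mod_eq)
  then have nsum: "n = q * m + (q * p + r)" using qm' by (simp add: r_def)
  have r: "d < r" "r \<le> 2 * d + 1"
    using mod_less_divisor[OF q, of "n - q * m"] by (simp_all add: r_def q_def)
  have nr: "real n = real q * real m + (real q * real p + real r)" using nsum by (metis of_nat_add of_nat_mult)
  have rq: "real r \<le> 2 * real q" using r by (simp add: q_def)
  have \<kappa>m: "\<kappa> * real n \<le> real m"
  proof -
    have "\<kappa> * real n \<le> c / real q * real n" unfolding \<kappa>_def by (intro mult_right_mono divide_right_mono) auto
    also have "\<dots> \<le> real m" using m(1) q by (simp add: field_simps)
    finally show ?thesis .
  qed
  have \<kappa>p: "\<kappa> * real n \<le> real p"
  proof -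
    have "\<kappa> * real n \<le> ((1 - c) / 2) / real q * real n"
      unfolding \<kappa>_def by (intro mult_right_mono divide_right_mono min.cobounded2) auto
    moreover have "(1 - c) / 2 * real n \<le> real q * real p"
    proof -
      have "(1 - c) * real n = real n - c * real n" by (simp add: left_diff_distrib)
      then have "(1 - c) * real n \<le> 2 * (real q * real p)" using nr rq m(2) big by linarith
      then show ?thesis by linarith
    qed
    then have "((1 - c) / 2) / real q * real n \<le> real p" using q by (simp add: field_simps)
    ultimately show ?thesis by linarith
  qed
  \<comment> \<open>Since \<open>d * q = d * (d + 1)\<close> is even, the parity of
    \<open>d * n\<close> passes to \<open>d * r\<close>.\<close>
  have evr: "even (d * r)"
  proof -
    have "d * n = d * q * (m + p) + d * r" using nsum by (simp add: algebra_simps)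
    moreover have "even (d * q * (m + p))" by (simp add: q_def)
    ultimately show ?thesis using ev by (metis even_add)
  qed
  have "fact m ^ d * (fact p ^ (d * (d + 1) div 2) * 1)
     \<le> card (regular_graphs d (q * m) (m * (q choose 3))) * (card (regular_graphs d (q * p) 0) * card (regular_graphs d r 0))"
    using card_clique_graphs_ge[of m d] card_regular_graphs_ge[of p d] regular_graph_exists[OF r(1) evr]
    by (intro mult_le_mono) (simp_all add: q_def)
  also have "\<dots> \<le> card (regular_graphs d (q * m) (m * (q choose 3))) * card (regular_graphs d (q * p + r) (0 + 0))"
    by (intro mult_le_mono2 card_regular_graphs_mult_le)
  also have "\<dots> \<le> card (regular_graphs d (q * m + (q * p + r)) (m * (q choose 3) + (0 + 0)))"
    by (rule card_regular_graphs_mult_le)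
  also have "\<dots> \<le> card (G_dc d c n)"
    unfolding nsum[symmetric]
    using m(1) by (intro card_mono finite_G_dc regular_graphs_subset_G_dc[where m = m]) (simp_all add: q_def algebra_simps)
  finally have "real (fact m ^ d * fact p ^ (d * (d + 1) div 2)) \<le> real (card (G_dc d c n))"
    by (simp only: of_nat_le_iff mult_1_right)
  then have lower: "fact m ^ d * fact p ^ (d * (d + 1) div 2) \<le> real (card (G_dc d c n))" by simp
  let ?l = "ln (real n) - (1 - ln \<kappa>)"
  define X where "X = real d * real m + real d * real q / 2 * real p"
  have half: "real (d * (d + 1) div 2) = real d * real q / 2"
    by (simp add: q_def real_of_nat_div algebra_simps)
  have "exp (X * ?l) = exp (real m * ?l) ^ d * exp (real p * ?l) ^ (d * (d + 1) div 2)"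
    unfolding X_def exp_of_nat_mult[symmetric] half exp_add[symmetric]
    by (simp only: distrib_right mult.assoc)
  also have "\<dots> \<le> fact m ^ d * fact p ^ (d * (d + 1) div 2)"
    using fact_ge_exp[OF \<kappa>(1) \<kappa>m] fact_ge_exp[OF \<kappa>(1) \<kappa>p] n0 by (intro mult_mono power_mono) auto
  also note lower
  finally have low: "exp (X * ?l) \<le> real (card (G_dc d c n))" .
  \<comment> \<open>Eliminate \<open>p\<close>. On \<open>d + 1\<close> nodes a clique contributes
    \<open>d\<close> to the exponent where the lift contributes \<open>d (d + 1) / 2\<close>, a loss
    of \<open>d (d - 1) / 2\<close> per clique.\<close>
  have X: "X = real d * real n / 2 - real m * (real d * (real d - 1)) / 2 - real d * real r / 2"
    unfolding nr by (simp add: X_def q_def field_simps)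
  have dd: "0 \<le> real d * (real d - 1)" by (cases d) auto
  have X_upper: "X \<le> real d * real n"
  proof -
    have "0 \<le> real m * (real d * (real d - 1))" "0 \<le> real d * real r" "0 \<le> real d * real n" using dd by simp_all
    then show ?thesis unfolding X by linarith
  qed
  have X_lower: "entropy_rate d c * real n - M \<le> X"
  proof -
    have "real m \<le> c * real n / (real d + 1) + 1" using m(2) by (simp add: q_def field_simps)
    then have "real m * (real d * (real d - 1)) \<le> (c * real n / (real d + 1) + 1) * (real d * (real d - 1))"
      using dd by (rule mult_right_mono)
    moreover have "real d * real r \<le> real d * (2 * real d + 1)"
      using r(2) by (intro mult_left_mono) linarith+
    moreover have eq: "entropy_rate d c * real n - M = real d * real n / 2
      - (c * real n / (real d + 1) + 1) * (real d * (real d - 1)) / 2 - real d * (2 * real d + 1) / 2"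
      by (simp add: entropy_rate_def M_def field_simps)
    ultimately show ?thesis unfolding X eq by (intro diff_mono order_refl divide_right_mono) simp_all
  qed
  have "(entropy_rate d c * real n - M) * ln (real n) - K * real n \<le> X * ?l"
  proof -
    have "(entropy_rate d c * real n - M) * ln (real n) \<le> X * ln (real n)"
      using X_lower n0 by (intro mult_right_mono) auto
    moreover have "X * (1 - ln \<kappa>) \<le> real d * real n * (1 - ln \<kappa>)"
      using X_upper
    proof (rule mult_right_mono)
      have "ln \<kappa> \<le> 0" using \<kappa> by simp
      then show "0 \<le> 1 - ln \<kappa>" by linarith
    qed
    ultimately show ?thesis by (simp add: K_def algebra_simps)
  qed
  then show "exp ((entropy_rate d c * real n - M) * ln (real n) - K * real n) \<le> real (card (G_dc d c n))"
    using low by (meson exp_le_cancel_iff order_trans)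
qed

text \<open>The triangle threshold and the \<open>b\<close> bad nodes enter the bound on the mean
  number of paid edges, and \<open>card_graphs_le\<close> turns it into a count.\<close>

lemma card_many_bad_le:
  assumes n: "n > 0"
  shows "real (card {E \<in> G_dc d c n. b \<le> real (card (bad_nodes d n E))})
    \<le> exp ((entropy_rate d c * real n - b / (2 * (real d + 1)\<^sup>2)) * ln (real n)
          + (real (d * d) * ln 2 + 1) * real n)"
proof -
  let ?A = "entropy_rate d c * real n - b / (2 * (real d + 1)\<^sup>2)"
  have "real (card {E \<in> G_dc d c n. b \<le> real (card (bad_nodes d n E))})
     \<le> exp (?A * ln (real n)) * ((2 ^ (d * d)) ^ n * exp (real n))"
  proof (rule card_graphs_le[OF n])
    fix E assume E: "E \<in> {E \<in> G_dc d c n. b \<le> real (card (bad_nodes d n E))}"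
    then have sE: "simple_graph n E" "regular d n E" by (auto simp: G_dc_def)
    have "c * (real d * (real d - 1)) / 2 * real n \<le> 3 * real (card (triangles n E))"
      using E by (simp add: G_dc_def T_max_def real_choose_two)
    then have "c * (real d * (real d - 1)) / 2 * real n / (real d + 1) \<le> 3 * real (card (triangles n E)) / (real d + 1)"
      by (intro divide_right_mono) auto
    moreover have "b / (2 * (real d + 1)\<^sup>2) \<le> real (card (bad_nodes d n E)) / (2 * (real d + 1)\<^sup>2)"
      using E by (intro divide_right_mono) auto
    moreover have "?A = real d * real n / 2 - c * (real d * (real d - 1)) / 2 * real n / (real d + 1) - b / (2 * (real d + 1)\<^sup>2)"
      by (simp add: entropy_rate_def algebra_simps)
    ultimately have "(\<Sum>e\<in>E. 2 / (real (card (common_nbs E e)) + 2)) \<le> ?A"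
      using sum_two_over_le[OF sE] by linarith
    then show "simple_graph n E \<and> regular d n E \<and> (\<Sum>e\<in>E. 2 / (real (card (common_nbs E e)) + 2)) \<le> ?A"
      using sE by simp
  qed
  also have "(2 ^ (d * d)) ^ n * exp (real n) = exp ((real (d * d) * ln 2 + 1) * real n)"
  proof -
    have "(2 :: real) ^ (d * d) = exp (real (d * d) * ln 2)" by (subst exp_of_nat_mult) simp
    then show ?thesis by (simp add: exp_of_nat2_mult[symmetric] exp_add[symmetric] algebra_simps)
  qed
  finally show ?thesis by (simp add: exp_add[symmetric])
qed

text \<open>Divide the upper bound for graphs with many bad nodes by the lower bound for the class.
  The entropy terms cancel, and what remains tends to \<open>0\<close>.\<close>

lemma bad_nodes_few:
  fixes d :: nat and c \<epsilon> :: real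
  assumes c: "0 < c" "c < 1" and \<epsilon>: "\<epsilon> > 0"
  shows "\<exists>N. \<forall>n\<ge>N. G_dc d c n \<noteq> {} \<longrightarrow>
            prob_G d c n (\<lambda>E. real (card (bad_nodes d n E)) < ln (ln (real n)) / ln (real n) * real n)
              > 1 - \<epsilon>"
proof -
  obtain M K :: real and N0 :: nat where lower: "\<And>n. n \<ge> N0 \<Longrightarrow> even (d * n) \<Longrightarrow>
       exp ((entropy_rate d c * real n - M) * ln (real n) - K * real n) \<le> real (card (G_dc d c n))"
    using card_G_dc_ge[OF c, of d] by metis
  define C where "C = real (d * d) * ln 2 + 1 + K"
  define \<epsilon>1 where "\<epsilon>1 = 1 / (2 * (real d + 1)\<^sup>2)"
  have \<epsilon>1: "\<epsilon>1 > 0" by (simp add: \<epsilon>1_def)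
  \<comment> \<open>The exponent of the quotient. Its negative term comes from
    \<open>b ln n = n ln (ln n)\<close> at the threshold \<open>b\<close>, and it outgrows the
    linear term.\<close>
  have "filterlim (\<lambda>n::nat. M * ln n + C * n - \<epsilon>1 * n * ln (ln n)) at_bot at_top"
    using \<epsilon>1 by real_asymp
  then have "eventually (\<lambda>n. M * ln (real n) + C * real n - \<epsilon>1 * real n * ln (ln (real n)) < ln \<epsilon>) at_top"
    by (simp add: filterlim_at_bot_dense)
  then obtain N1 where N1: "\<And>n. n \<ge> N1 \<Longrightarrow> M * ln (real n) + C * real n - \<epsilon>1 * real n * ln (ln (real n)) < ln \<epsilon>"
    by (auto simp: eventually_at_top_linorder)
  show ?thesis
  proof (intro exI[of _ "max 2 (max N0 N1)"] allI impI)
    \<comment> \<open>The \<open>2\<close> makes \<open>ln n\<close> positive, so that it cancels in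
      the threshold.\<close>
    fix n assume n: "n \<ge> max 2 (max N0 N1)" and ne: "G_dc d c n \<noteq> {}"
    let ?b = "ln (ln (real n)) / ln (real n) * real n"
    let ?G = "G_dc d c n"
    let ?X = "{E \<in> ?G. ?b \<le> real (card (bad_nodes d n E))}"
    let ?Y = "{E \<in> ?G. real (card (bad_nodes d n E)) < ?b}"
    have ln: "ln (real n) > 0" using n by simp
    have G: "real (card ?G) > 0" using ne finite_G_dc by (simp add: card_gt_0_iff)
    have "real (card ?X) \<le> exp ((entropy_rate d c * real n - ?b / (2 * (real d + 1)\<^sup>2)) * ln (real n)
          + (real (d * d) * ln 2 + 1) * real n)"
      using n by (intro card_many_bad_le) simp
    also have "\<dots> < exp (ln \<epsilon> + ((entropy_rate d c * real n - M) * ln (real n) - K * real n))"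
    proof -
      have "?b / (2 * (real d + 1)\<^sup>2) * ln (real n) = \<epsilon>1 * real n * ln (ln (real n))"
        using ln by (simp add: \<epsilon>1_def)
      then show ?thesis using N1[of n] n by (simp add: C_def algebra_simps)
    qed
    also have "\<dots> \<le> \<epsilon> * real (card ?G)"
      using lower[of n] n G_dc_even[OF ne] \<epsilon> by (simp add: exp_add)
    finally have X: "real (card ?X) < \<epsilon> * real (card ?G)" .
    have "card ?G = card ?X + card ?Y"
    proof -
      have "?G = ?X \<union> ?Y" by auto
      moreover have "card (?X \<union> ?Y) = card ?X + card ?Y"
        using finite_G_dc by (intro card_Un_disjoint) auto
      ultimately show ?thesis by simp
    qed
    then have "real (card ?Y) > (1 - \<epsilon>) * real (card ?G)" using X by (simp add: algebra_simps)
    then show "prob_G d c n (\<lambda>E. real (card (bad_nodes d n E)) < ?b) > 1 - \<epsilon>"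
      using G by (simp add: prob_G_def pos_less_divide_eq)
  qed
qed

theorem theorem2:
  fixes d :: nat and c :: real
  assumes "0 < c" and "c < 1"
  shows "(\<forall>\<epsilon>>0. \<exists>N. \<forall>n\<ge>N. G_dc d c n \<noteq> {} \<longrightarrow>
            prob_G d c n (\<lambda>E. real (card (bad_nodes d n E)) < ln (ln (real n)) / ln (real n) * real n)
              > 1 - \<epsilon>)
       \<and> (\<forall>\<delta>>0. \<forall>\<epsilon>>0. \<exists>N. \<forall>n\<ge>N. G_dc d c n \<noteq> {} \<longrightarrow>
            prob_G d c n (\<lambda>E. real (card (nonclique_triangles d n E)) \<le> \<delta> * real n)
              > 1 - \<epsilon>)"
proof (intro conjI allI impI)
  fix \<epsilon> :: real assume "\<epsilon> > 0"
  then show "\<exists>N. \<forall>n\<ge>N. G_dc d c n \<noteq> {} \<longrightarrow>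
            prob_G d c n (\<lambda>E. real (card (bad_nodes d n E)) < ln (ln (real n)) / ln (real n) * real n)
              > 1 - \<epsilon>"
    using bad_nodes_few assms by blast
next
  fix \<delta> \<epsilon> :: real assume \<delta>: "\<delta> > 0" and \<epsilon>: "\<epsilon> > 0"
  let ?b = "\<lambda>n. ln (ln (real n)) / ln (real n) * real n"
  obtain N0 where N0: "\<And>n. n \<ge> N0 \<Longrightarrow> G_dc d c n \<noteq> {} \<Longrightarrow>
      prob_G d c n (\<lambda>E. real (card (bad_nodes d n E)) < ?b n) > 1 - \<epsilon>"
    using bad_nodes_few[OF assms \<epsilon>] by metis
  \<comment> \<open>Fewer than \<open>n ln (ln n) / ln n\<close> bad nodes leave at most
    \<open>2 ^ d\<close> times as many triangles outside the cliques, and this factor of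
    \<open>n\<close> tends to \<open>0\<close>.\<close>
  have "((\<lambda>n::nat. 2 ^ d * (ln (ln (real n)) / ln (real n))) \<longlongrightarrow> 2 ^ d * 0) at_top"
    by (intro tendsto_mult tendsto_const) real_asymp
  then have "eventually (\<lambda>n. 2 ^ d * (ln (ln (real n)) / ln (real n)) < \<delta>) at_top"
    using \<delta> order_tendstoD(2) by fastforce
  then obtain N1 where N1: "\<And>n. n \<ge> N1 \<Longrightarrow> 2 ^ d * (ln (ln (real n)) / ln (real n)) < \<delta>"
    by (auto simp: eventually_at_top_linorder)
  show "\<exists>N. \<forall>n\<ge>N. G_dc d c n \<noteq> {} \<longrightarrow>
      prob_G d c n (\<lambda>E. real (card (nonclique_triangles d n E)) \<le> \<delta> * real n) > 1 - \<epsilon>"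
  proof (intro exI[of _ "max N0 N1"] allI impI)
    fix n assume n: "n \<ge> max N0 N1" and ne: "G_dc d c n \<noteq> {}"
    have "real (card (nonclique_triangles d n E)) \<le> \<delta> * real n"
      if E: "E \<in> G_dc d c n" and b: "real (card (bad_nodes d n E)) < ?b n" for E
    proof -
      have "real (card (nonclique_triangles d n E)) \<le> real (2 ^ d * card (bad_nodes d n E))"
        using card_nonclique_triangles_le[of n E d] E unfolding of_nat_le_iff by (simp add: G_dc_def)
      also have "\<dots> = 2 ^ d * real (card (bad_nodes d n E))" by simp
      also have "\<dots> \<le> 2 ^ d * ?b n" using b by (intro mult_left_mono) auto
      also have "\<dots> = 2 ^ d * (ln (ln (real n)) / ln (real n)) * real n" by simp
      also have "\<dots> \<le> \<delta> * real n" using N1[of n] n by (intro mult_right_mono) auto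
      finally show ?thesis .
    qed
    then have "card {E \<in> G_dc d c n. real (card (bad_nodes d n E)) < ?b n}
        \<le> card {E \<in> G_dc d c n. real (card (nonclique_triangles d n E)) \<le> \<delta> * real n}"
      using finite_G_dc by (intro card_mono) auto
    then have "prob_G d c n (\<lambda>E. real (card (bad_nodes d n E)) < ?b n)
        \<le> prob_G d c n (\<lambda>E. real (card (nonclique_triangles d n E)) \<le> \<delta> * real n)"
      unfolding prob_G_def by (intro divide_right_mono) auto
    moreover have "prob_G d c n (\<lambda>E. real (card (bad_nodes d n E)) < ?b n) > 1 - \<epsilon>"
      using N0 n ne by simp
    ultimately show "prob_G d c n (\<lambda>E. real (card (nonclique_triangles d n E)) \<le> \<delta> * real n) > 1 - \<epsilon>"
      by linarith
  qed
qed

end
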